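(* Let $\alpha\ge 2$ be an integer, $s\in\mathbb{N}$, and let $\boldsymbol{\gamma}=(\gamma_u)_{u\subseteq 1:s}$ be a set of weights with $\gamma_u\ge 0$. Then, as sets, $\mathcal{H}(K_{\alpha,\boldsymbol{\gamma},s}^{\mathrm{kor}+\mathrm{cos}})$ is strictly smaller than $\mathcal{H}(K_{\alpha,\boldsymbol{\gamma},s}^{\mathrm{sob}})$, i.e. it is a strict subset of $\mathcal{H}(K_{\alpha,\boldsymbol{\gamma},s}^{\mathrm{sob}})$.
   Context: $\mathbb{N}$ is the set of positive integers and $1:s=\{1,\ldots,s\}$. For a reproducing kernel $K:[0,1]^s\times[0,1]^s\to\mathbb{R}$, $\mathcal{H}(K)$ is the reproducing kernel Hilbert space of real-valued functions on $[0,1]^s$ with kernel $K$. Both kernels have the form $$K_{\alpha,\boldsymbol{\gamma},s}^{\bullet}(\boldsymbol{x},\boldsymbol{y})=1+\sum_{\emptyset\ne u\subseteq 1:s}\gamma_u\prod_{j\in u}\left[-1+K_{\alpha,1,1}^{\bullet}(x_j,y_j)\right],$$ with univariate kernels $$K_{\alpha,1,1}^{\mathrm{kor}+\mathrm{cos}}(x,y)=1+\sum_{k=1}^{\infty}\frac{\cos(2\pi k(x-y))+\cos(\pi kx)\cos(\pi ky)}{k^{2\alpha}}$$ (sum of the Korobov space and the half-period cosine space) and $$K_{\alpha,1,1}^{\mathrm{sob}}(x,y)=1+\sum_{\tau=1}^{\alpha}\frac{B_\tau(x)B_\tau(y)}{(\tau!)^2}+(-1)^{\alpha+1}\frac{B_{2\alpha}(|x-y|)}{(2\alpha)!}$$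 (non-periodic Sobolev space of order $\alpha$), where $B_\tau$ is the Bernoulli polynomial of degree $\tau$. As a set, $\mathcal{H}(K_{\alpha,1,1}^{\mathrm{sob}})$ consists of all $f:[0,1]\to\mathbb{R}$ with $f^{(\tau)}$ absolutely continuous for $\tau=0,\ldots,\alpha-1$ and $f^{(\alpha)}\in L^2[0,1]$.
   Formalization: Adds the assumption that γ_u > 0 for at least one nonempty u; if γ_u = 0 for all nonempty u, both kernels equal 1, both spaces consist of the constants, and the inclusion is not strict. *)

theory Defs
  imports "HOL-Analysis.Analysis"
begin

text \<open>
  A function on \<open>D\<close> is an element of \<^term>\<open>extensional D\<close>, so that equality of
  functions is equality on \<open>D\<close>. A Hilbert space of functions consists of a carrier \<open>H\<close> and an
  inner product \<open>ip\<close>, of which only the values on \<open>H\<close> matter.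
\<close>

locale function_hilbert_space =
  fixes D :: "'a set" and H :: "('a \<Rightarrow> real) set"
    and ip :: "('a \<Rightarrow> real) \<Rightarrow> ('a \<Rightarrow> real) \<Rightarrow> real"
  assumes extensional: "H \<subseteq> extensional D"
    and zero_mem: "(\<lambda>x\<in>D. 0) \<in> H"
    and add_mem: "\<lbrakk>f \<in> H; g \<in> H\<rbrakk> \<Longrightarrow> (\<lambda>x\<in>D. f x + g x) \<in> H"
    and scale_mem: "f \<in> H \<Longrightarrow> (\<lambda>x\<in>D. c * f x) \<in> H"
    and ip_commute: "\<lbrakk>f \<in> H; g \<in> H\<rbrakk> \<Longrightarrow> ip f g = ip g f"
    and ip_add_left:
      "\<lbrakk>f \<in> H; g \<in> H; h \<in> H\<rbrakk> \<Longrightarrow> ip (\<lambda>x\<in>D. f x + g x) h = ip f h + ip g h"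
    and ip_scale_left: "\<lbrakk>f \<in> H; g \<in> H\<rbrakk> \<Longrightarrow> ip (\<lambda>x\<in>D. c * f x) g = c * ip f g"
    and ip_nonneg: "f \<in> H \<Longrightarrow> 0 \<le> ip f f"
    and ip_definite: "\<lbrakk>f \<in> H; ip f f = 0\<rbrakk> \<Longrightarrow> f = (\<lambda>x\<in>D. 0)"
    and complete:
      "\<lbrakk>range F \<subseteq> H;
        \<forall>e>0. \<exists>N. \<forall>m\<ge>N. \<forall>n\<ge>N.
          sqrt (ip (\<lambda>x\<in>D. F m x - F n x) (\<lambda>x\<in>D. F m x - F n x)) < e\<rbrakk>
       \<Longrightarrow> \<exists>f\<in>H. (\<lambda>n. sqrt (ip (\<lambda>x\<in>D. F n x - f x) (\<lambda>x\<in>D. F n x - f x))) \<longlonglongrightarrow> 0"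

locale reproducing_kernel_hilbert_space = function_hilbert_space D H ip
  for D :: "'a set" and H and ip +
  fixes K :: "'a \<Rightarrow> 'a \<Rightarrow> real"
  assumes kernel_mem: "y \<in> D \<Longrightarrow> (\<lambda>x\<in>D. K x y) \<in> H"
    and reproducing: "\<lbrakk>f \<in> H; y \<in> D\<rbrakk> \<Longrightarrow> ip f (\<lambda>x\<in>D. K x y) = f y"

text \<open>
  The underlying set of the Hilbert space of functions on \<open>D\<close> with kernel \<open>K\<close>. For a positive
  semidefinite \<open>K\<close> the Moore--Aronszajn theorem makes the description proper.
\<close>

definition RKHS :: "'a set \<Rightarrow> ('a \<Rightarrow> 'a \<Rightarrow> real) \<Rightarrow> ('a \<Rightarrow> real) set" where
  "RKHS D K = (THE H. \<exists>ip. reproducing_kernel_hilbert_space D H ip K)"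

fun bernoulli_number :: "nat \<Rightarrow> real" where
  "bernoulli_number 0 = 1"
| "bernoulli_number (Suc n) =
     - (\<Sum>k\<le>n. real (Suc (Suc n) choose k) * bernoulli_number k) / real (Suc (Suc n))"

definition bernoulli_poly :: "nat \<Rightarrow> real \<Rightarrow> real" where
  "bernoulli_poly n x = (\<Sum>k\<le>n. real (n choose k) * bernoulli_number k * x ^ (n - k))"

definition korcos_kernel1 :: "nat \<Rightarrow> real \<Rightarrow> real \<Rightarrow> real" where
  "korcos_kernel1 \<alpha> x y = 1 + (\<Sum>n. let k = real (Suc n) in
     (cos (2 * pi * k * (x - y)) + cos (pi * k * x) * cos (pi * k * y)) / k ^ (2 * \<alpha>))"

definition sob_kernel1 :: "nat \<Rightarrow> real \<Rightarrow> real \<Rightarrow> real" where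
  "sob_kernel1 \<alpha> x y = 1
     + (\<Sum>\<tau>=1..\<alpha>. bernoulli_poly \<tau> x * bernoulli_poly \<tau> y / (fact \<tau>)\<^sup>2)
     + (-1) ^ (\<alpha> + 1) * bernoulli_poly (2 * \<alpha>) \<bar>x - y\<bar> / fact (2 * \<alpha>)"

text \<open>
  The finite type \<open>'s\<close> plays the role of the coordinate set \<open>{1, \<dots>, s}\<close>, with
  \<open>s = CARD('s)\<close>. The weight of the empty set does not occur.
\<close>

definition weighted_kernel ::
  "(real \<Rightarrow> real \<Rightarrow> real) \<Rightarrow> ('s::finite set \<Rightarrow> real) \<Rightarrow> real ^ 's \<Rightarrow> real ^ 's \<Rightarrow> real" where
  "weighted_kernel k \<gamma> x y =
     1 + (\<Sum>u | u \<noteq> {}. \<gamma> u * (\<Prod>j\<in>u. - 1 + k (x $ j) (y $ j)))"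

definition korcos_kernel ::
  "nat \<Rightarrow> ('s::finite set \<Rightarrow> real) \<Rightarrow> real ^ 's \<Rightarrow> real ^ 's \<Rightarrow> real" where
  "korcos_kernel \<alpha> = weighted_kernel (korcos_kernel1 \<alpha>)"

definition sob_kernel ::
  "nat \<Rightarrow> ('s::finite set \<Rightarrow> real) \<Rightarrow> real ^ 's \<Rightarrow> real ^ 's \<Rightarrow> real" where
  "sob_kernel \<alpha> = weighted_kernel (sob_kernel1 \<alpha>)"

definition unit_cube :: "(real ^ 's::finite) set" where
  "unit_cube = {x. \<forall>j. x $ j \<in> {0..1}}"

text \<open>
  If every nonempty set of coordinates has weight zero, both kernels are the constant \<open>1\<close>: a strict
  inclusion between the two spaces requires a positive weight.
\<close>

lemma RKHS_eq_if_weights_zero: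
  assumes "\<And>u. u \<noteq> {} \<Longrightarrow> \<gamma> u = 0"
  shows "RKHS unit_cube (korcos_kernel \<alpha> \<gamma>) = RKHS unit_cube (sob_kernel \<alpha> \<gamma>)"
proof -
  have "weighted_kernel k \<gamma> = (\<lambda>x y. 1)" for k
    using assms by (intro ext) (simp add: weighted_kernel_def)
  then show ?thesis
    by (simp add: korcos_kernel_def sob_kernel_def)
qed

end

(*
A positive semidefinite kernel K on D has a unique Hilbert space, and f belongs to it iff
(sum c_i f(x_i))^2 <= C sum c_i c_j K(x_i, x_j) for some C and all finite families.  Hence the space of
K is contained in that of L as soon as c L - K is positive semidefinite for some c, a relation that
passes from the univariate kernels to weighted tensor products by Schur's product theorem.

Univariate inclusion: by the Euler-Maclaurin formula the Sobolev kernel (without its constant) is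
sum_{0<i<a} b_i(x) b_i(y) + int R(x,t) R(y,t) dt, where b_i = B_i / i!, R(x,t) = b_a(x) - b_a({x-t})
and {u} is the fractional part; any f with mean zero is represented by the same features with
coefficients f^(i-1)(1) - f^(i-1)(0) and f^(a).  For the trigonometric functions spanning the smaller
space the a-th derivatives are orthogonal, so Bessel's inequality bounds the sum of their squares.

Strictness: functions f of the smaller univariate space satisfy f'(0) = f'(1), which B_2 violates.
Quantitatively, the functional f(1) - f(1-d) - f(d) + f(0) has size d on B_2, but its squared norm on
the smaller space is O(d^(5/2)).  In s variables take the product of B_2 over a set of positive weight.
*)
theory Submission
  imports Defs
begin

section \<open>Positive semidefinite kernels and their Hilbert spaces\<close>

text \<open>\<open>RKHS\<close> is a definite description, so nothing about it can be derived before
  one Hilbert space with the kernel is constructed and every other one is shown to have the same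
  carrier. From then on the membership criterion is the only interface, and all comparisons are
  inequalities between quadratic forms of finite functionals. The obstacle in the univariate
  inclusion is that the Sobolev features and the trigonometric ones are not orthogonal to each other
  in any common sense. Euler-Maclaurin separates finitely many boundary values, which are estimated
  crudely, from an L2 pairing with R, where orthogonality of the derivatives is exploited. In the
  smaller space f'(0) = f'(1), because cos(pi k x) has vanishing derivative at both ends and the
  other features have period 1. The exponent 5/2 is one choice between 2, which must be exceeded to
  beat the square of d, and 3, where the sum over the frequencies for a = 2 would diverge.\<close>

text \<open>A list \<open>xs\<close> of coefficients and points stands for the functional
  \<open>f \<mapsto> \<Sum>i. c\<^sub>i f(x\<^sub>i)\<close>.\<close>

definition lin :: "(real \<times> 'a) list \<Rightarrow> ('a \<Rightarrow> real) \<Rightarrow> real" where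
  "lin xs f = (\<Sum>(c, x)\<leftarrow>xs. c * f x)"

definition scale :: "real \<Rightarrow> (real \<times> 'a) list \<Rightarrow> (real \<times> 'a) list" where
  "scale t xs = map (\<lambda>(c, x). (t * c, x)) xs"

definition form :: "('a \<Rightarrow> 'a \<Rightarrow> real) \<Rightarrow> (real \<times> 'a) list \<Rightarrow> (real \<times> 'a) list \<Rightarrow> real" where
  "form K xs ys = lin xs (\<lambda>x. lin ys (\<lambda>y. K x y))"

text \<open>Points may repeat and coefficients may vanish, so \<open>@\<close> and
  \<open>scale\<close> act as the vector space operations on functionals and no normal form has to
  be maintained.\<close>

definition combos :: "'a set \<Rightarrow> (real \<times> 'a) list set" where
  "combos D = {xs. snd ` set xs \<subseteq> D}"

lemma lin_Nil [simp]: "lin [] f = 0"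
  by (simp add: lin_def)

lemma lin_Cons [simp]: "lin ((c, x) # xs) f = c * f x + lin xs f"
  by (simp add: lin_def)

lemma lin_append [simp]: "lin (xs @ ys) f = lin xs f + lin ys f"
  by (simp add: lin_def)

lemma lin_scale [simp]: "lin (scale t xs) f = t * lin xs f"
  by (induction xs) (auto simp: lin_def scale_def algebra_simps)

lemma lin_add: "lin xs (\<lambda>x. f x + g x) = lin xs f + lin xs g"
  by (induction xs) (auto simp: algebra_simps)

lemma lin_diff: "lin xs (\<lambda>x. f x - g x) = lin xs f - lin xs g"
  by (induction xs) (auto simp: algebra_simps)

lemma lin_cmult: "lin xs (\<lambda>x. c * f x) = c * lin xs f"
  by (induction xs) (auto simp: algebra_simps)

lemma lin_cmult_right: "lin xs (\<lambda>x. f x * c) = lin xs f * c"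
  by (induction xs) (auto simp: algebra_simps)

lemma lin_zero [simp]: "lin xs (\<lambda>x. 0) = 0"
  by (induction xs) auto

lemma lin_sum: "lin xs (\<lambda>x. \<Sum>i\<in>I. f i x) = (\<Sum>i\<in>I. lin xs (f i))"
  by (induction I rule: infinite_finite_induct) (auto simp: lin_add)

lemma lin_cong:
  assumes "xs \<in> combos D" "\<And>x. x \<in> D \<Longrightarrow> f x = g x"
  shows "lin xs f = lin xs g"
  using assms by (induction xs) (auto simp: combos_def)

lemma lin_restrict: "xs \<in> combos D \<Longrightarrow> lin xs (\<lambda>x\<in>D. f x) = lin xs f"
  by (rule lin_cong) auto

lemma lin_map: "lin (map (\<lambda>(c, x). (c * g x, h x)) xs) f = lin xs (\<lambda>x. g x * f (h x))"
  by (induction xs) (auto simp: algebra_simps)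

lemma lin_swap: "lin xs (\<lambda>x. lin ys (K x)) = lin ys (\<lambda>y. lin xs (\<lambda>x. K x y))"
  by (induction xs) (auto simp: lin_add lin_cmult)

lemma tendsto_lin:
  assumes "xs \<in> combos D" "\<And>x. x \<in> D \<Longrightarrow> (\<lambda>n. F n x) \<longlonglongrightarrow> f x"
  shows "(\<lambda>n. lin xs (F n)) \<longlonglongrightarrow> lin xs f"
  using assms(1)
proof (induction xs)
  case (Cons p xs)
  then show ?case
    by (cases p) (auto simp: combos_def intro!: tendsto_intros assms(2))
qed auto

lemma sums_lin:
  assumes "xs \<in> combos D" "\<And>x. x \<in> D \<Longrightarrow> (\<lambda>n. F n x) sums f x"
  shows "(\<lambda>n. lin xs (F n)) sums lin xs f"
  using tendsto_lin[OF assms(1), of "\<lambda>n x. \<Sum>i<n. F i x" f] assms(2)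
  by (simp add: sums_def lin_sum)

lemma combos_append [simp]: "xs @ ys \<in> combos D \<longleftrightarrow> xs \<in> combos D \<and> ys \<in> combos D"
  by (auto simp: combos_def)

lemma combos_scale [simp]: "xs \<in> combos D \<Longrightarrow> scale t xs \<in> combos D"
  by (auto simp: combos_def scale_def)

lemma combos_Nil [simp]: "[] \<in> combos D"
  by (simp add: combos_def)

lemma combos_Cons [simp]: "(c, x) # xs \<in> combos D \<longleftrightarrow> x \<in> D \<and> xs \<in> combos D"
  by (auto simp: combos_def)

lemma combos_map:
  assumes "xs \<in> combos D" "\<And>x. x \<in> D \<Longrightarrow> h x \<in> E"
  shows "map (\<lambda>(c, x). (c * g x, h x)) xs \<in> combos E"
  using assms by (force simp: combos_def)

lemma form_append_left [simp]: "form K (xs @ ys) zs = form K xs zs + form K ys zs"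
  and form_append_right [simp]: "form K xs (ys @ zs) = form K xs ys + form K xs zs"
  and form_scale_left [simp]: "form K (scale t xs) ys = t * form K xs ys"
  and form_scale_right [simp]: "form K xs (scale t ys) = t * form K xs ys"
  by (simp_all add: form_def lin_add lin_cmult)

lemma form_cong:
  assumes "xs \<in> combos D" "ys \<in> combos D" "\<And>x y. x \<in> D \<Longrightarrow> y \<in> D \<Longrightarrow> K x y = L x y"
  shows "form K xs ys = form L xs ys"
  unfolding form_def by (intro lin_cong[OF assms(1)] lin_cong[OF assms(2)] assms(3))

lemma form_rank_one: "form (\<lambda>x y. f x * f y) xs xs = (lin xs f)\<^sup>2"
  by (simp add: form_def lin_cmult lin_cmult_right power2_eq_square)

lemma form_add: "form (\<lambda>x y. K x y + L x y) xs ys = form K xs ys + form L xs ys"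
  and form_diff: "form (\<lambda>x y. K x y - L x y) xs ys = form K xs ys - form L xs ys"
  and form_cmult: "form (\<lambda>x y. c * K x y) xs ys = c * form K xs ys"
  and form_sum: "form (\<lambda>x y. \<Sum>i\<in>I. M i x y) xs ys = (\<Sum>i\<in>I. form (M i) xs ys)"
  by (simp_all add: form_def lin_add lin_diff lin_cmult lin_sum)

lemma sums_form:
  assumes "xs \<in> combos D" "ys \<in> combos D"
    and "\<And>x y. x \<in> D \<Longrightarrow> y \<in> D \<Longrightarrow> (\<lambda>n. F n x y) sums K x y"
  shows "(\<lambda>n. form (F n) xs ys) sums form K xs ys"
  unfolding form_def by (intro sums_lin[OF assms(1)] sums_lin[OF assms(2)] assms(3))

text \<open>Minimising over t gives the discriminant inequality. The case c = 0 is included because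
  the forms are only semidefinite.\<close>

lemma discriminant_bound:
  fixes a b c :: real
  assumes "\<And>t. 0 \<le> a + 2 * t * b + t\<^sup>2 * c" "0 \<le> c"
  shows "b\<^sup>2 \<le> a * c"
proof (cases "c = 0")
  case True
  have "b = 0"
  proof (rule ccontr)
    assume "b \<noteq> 0"
    then show False
      \<comment> \<open>This t makes a + 2 t b equal to -1.\<close>
      using assms(1)[of "- (a + 1) / (2 * b)"] True by (simp add: field_simps)
  qed
  then show ?thesis using True by simp
next
  case False
  then have "c > 0" using assms(2) by simp
  then show ?thesis
    using assms(1)[of "- b / c"] by (simp add: field_simps power2_eq_square)
qed

text \<open>Boundedness of f as a functional on kernel sums. For a positive semidefinite kernel the
  least admissible C \<ge> 0 is the squared norm of f, by \<open>lin_le_ip\<close> and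
  \<open>ip_le\<close>.\<close>

definition rkhs_set :: "'a set \<Rightarrow> ('a \<Rightarrow> 'a \<Rightarrow> real) \<Rightarrow> ('a \<Rightarrow> real) set" where
  "rkhs_set D K = {f \<in> extensional D. \<exists>C. \<forall>xs\<in>combos D. (lin xs f)\<^sup>2 \<le> C * form K xs xs}"

lemma abs_less_if_square_less:
  fixes x e :: real
  assumes "x\<^sup>2 < e\<^sup>2" "0 < e"
  shows "\<bar>x\<bar> < e"
  using assms power_less_imp_less_base[of "\<bar>x\<bar>" 2 e] by simp

lemma rkhs_setI:
  assumes "f \<in> extensional D" "\<And>xs. xs \<in> combos D \<Longrightarrow> (lin xs f)\<^sup>2 \<le> C * form K xs xs"
  shows "f \<in> rkhs_set D K"
  using assms by (auto simp: rkhs_set_def)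

section \<open>Moore-Aronszajn: the Hilbert space of a positive semidefinite kernel\<close>

locale psd_kernel =
  fixes D :: "'a set" and K :: "'a \<Rightarrow> 'a \<Rightarrow> real"
  assumes kernel_sym: "\<lbrakk>x \<in> D; y \<in> D\<rbrakk> \<Longrightarrow> K x y = K y x"
    and form_nonneg: "xs \<in> combos D \<Longrightarrow> 0 \<le> form K xs xs"
begin

lemma form_commute:
  assumes "xs \<in> combos D" "ys \<in> combos D"
  shows "form K xs ys = form K ys xs"
proof -
  have "form K xs ys = lin ys (\<lambda>y. lin xs (\<lambda>x. K x y))"
    unfolding form_def by (rule lin_swap)
  also have "\<dots> = form K ys xs"
    unfolding form_def
    by (intro lin_cong[OF assms(2)] lin_cong[OF assms(1)]) (simp add: kernel_sym)
  finally show ?thesis .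
qed

lemma form_perturb:
  assumes "xs \<in> combos D" "ys \<in> combos D"
  shows "form K (xs @ scale t ys) (xs @ scale t ys)
    = form K xs xs + 2 * t * form K xs ys + t\<^sup>2 * form K ys ys"
  using form_commute[OF assms] by (simp add: algebra_simps power2_eq_square)

lemma form_Cauchy_Schwarz:
  assumes "xs \<in> combos D" "ys \<in> combos D"
  shows "(form K xs ys)\<^sup>2 \<le> form K xs xs * form K ys ys"
proof (rule discriminant_bound)
  fix t show "0 \<le> form K xs xs + 2 * t * form K xs ys + t\<^sup>2 * form K ys ys"
    using form_nonneg[of "xs @ scale t ys"] assms by (simp only: form_perturb) simp
qed (use assms form_nonneg in auto)

lemma rkhs_set_bound:
  assumes "f \<in> rkhs_set D K"
  shows "\<exists>C\<ge>0. \<forall>xs\<in>combos D. (lin xs f)\<^sup>2 \<le> C * form K xs xs"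
proof -
  obtain C where C: "\<And>xs. xs \<in> combos D \<Longrightarrow> (lin xs f)\<^sup>2 \<le> C * form K xs xs"
    using assms by (auto simp: rkhs_set_def)
  show ?thesis
  proof (intro exI[of _ "max C 0"] conjI ballI)
    fix xs :: "(real \<times> 'a) list" assume xs: "xs \<in> combos D"
    have "C * form K xs xs \<le> max C 0 * form K xs xs"
      by (intro mult_right_mono) (use form_nonneg[OF xs] in auto)
    then show "(lin xs f)\<^sup>2 \<le> max C 0 * form K xs xs" using C[OF xs] by simp
  qed auto
qed

text \<open>In the norm of the space to be constructed, the conclusion says
  \<open>\<parallel>f - \<Sum>i. c\<^sub>i K(\<cdot>, x\<^sub>i)\<parallel>\<^sup>2 \<le> e\<close>; near maximisers of \<open>2 f(xs) - \<parallel>xs\<parallel>\<^sup>2\<close> do it.\<close>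

lemma kernel_approximation:
  assumes "f \<in> rkhs_set D K" "e > 0"
  shows "\<exists>xs\<in>combos D. \<forall>zs\<in>combos D. (lin zs f - form K xs zs)\<^sup>2 \<le> e * form K zs zs"
proof -
  obtain C where C: "C \<ge> 0" "\<And>xs. xs \<in> combos D \<Longrightarrow> (lin xs f)\<^sup>2 \<le> C * form K xs xs"
    using rkhs_set_bound[OF assms(1)] by blast
  define J where "J xs = 2 * lin xs f - form K xs xs" for xs
  have J_le: "J xs \<le> C" if "xs \<in> combos D" for xs
  proof -
    define q where "q = form K xs xs"
    have q: "q \<ge> 0" using form_nonneg[OF that] by (simp add: q_def)
    have "(lin xs f)\<^sup>2 \<le> C * q" using C(2)[OF that] by (simp add: q_def)
    \<comment> \<open>The arithmetic-geometric mean inequality leaves a bound linear in q, which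
      cancels the form in \<open>J\<close>.\<close>
    also have "\<dots> \<le> ((C + q) / 2)\<^sup>2"
      using sum_squares_ge_zero[of "C - q" 0] by (simp add: power2_eq_square field_simps)
    finally have "\<bar>lin xs f\<bar> \<le> \<bar>(C + q) / 2\<bar>" unfolding abs_le_square_iff .
    then have "2 * lin xs f \<le> C + q" using q C(1) by (simp add: abs_le_iff)
    then show ?thesis by (simp add: J_def q_def)
  qed
  have bdd: "bdd_above (J ` combos D)" using J_le by (auto intro!: bdd_aboveI)
  have ne: "J ` combos D \<noteq> {}" using combos_Nil by blast
  obtain xs where xs: "xs \<in> combos D" "Sup (J ` combos D) - e < J xs"
    using less_cSup_iff[OF ne bdd, of "Sup (J ` combos D) - e"] \<open>e > 0\<close> by auto
  have "(lin zs f - form K xs zs)\<^sup>2 \<le> e * form K zs zs" if zs: "zs \<in> combos D" for zs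
  proof -
    \<comment> \<open>Since \<open>J xs\<close> is within e of the supremum, moving
      \<open>xs\<close> in the direction \<open>zs\<close> raises \<open>J\<close> by at most e. For
      arbitrary t this is the first order condition of a maximiser, up to e.\<close>
    have "0 \<le> e + 2 * t * (form K xs zs - lin zs f) + t\<^sup>2 * form K zs zs" for t
    proof -
      have "J (xs @ scale t zs) \<le> Sup (J ` combos D)"
        by (intro cSUP_upper bdd) (use xs zs in auto)
      then show ?thesis
        using xs unfolding J_def form_perturb[OF xs(1) zs] by (simp add: algebra_simps)
    qed
    from discriminant_bound[OF this form_nonneg[OF zs]]
    show ?thesis by (simp add: power2_commute)
  qed
  then show ?thesis using xs(1) by blast
qed

text \<open>Functionals whose kernel sums approximate f with squared error 1/(n+1); the inner
  product becomes a limit of finite forms along them.\<close>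

definition apx :: "('a \<Rightarrow> real) \<Rightarrow> nat \<Rightarrow> (real \<times> 'a) list" where
  "apx f n = (SOME xs. xs \<in> combos D \<and>
     (\<forall>zs\<in>combos D. (lin zs f - form K xs zs)\<^sup>2 \<le> inverse (real (Suc n)) * form K zs zs))"

lemma apx:
  assumes "f \<in> rkhs_set D K"
  shows apx_combos: "apx f n \<in> combos D"
    and apx_error: "\<And>zs. zs \<in> combos D \<Longrightarrow>
      (lin zs f - form K (apx f n) zs)\<^sup>2 \<le> inverse (real (Suc n)) * form K zs zs"
proof -
  have "\<exists>xs. xs \<in> combos D \<and>
     (\<forall>zs\<in>combos D. (lin zs f - form K xs zs)\<^sup>2 \<le> inverse (real (Suc n)) * form K zs zs)"
    using kernel_approximation[OF assms, of "inverse (real (Suc n))"] by auto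
  from someI_ex[OF this]
  show "apx f n \<in> combos D" "\<And>zs. zs \<in> combos D \<Longrightarrow>
      (lin zs f - form K (apx f n) zs)\<^sup>2 \<le> inverse (real (Suc n)) * form K zs zs"
    by (simp_all add: apx_def)
qed

text \<open>Both error bounds are tested on the difference functional itself. With q its form this
  gives q^2 \<le> c q, and one factor q cancels. Hence the approximations are Cauchy.\<close>

lemma apx_diff:
  assumes f: "f \<in> rkhs_set D K"
  defines "zs \<equiv> \<lambda>m n. apx f m @ scale (- 1) (apx f n)"
  shows "form K (zs m n) (zs m n) \<le> 2 * (inverse (real (Suc m)) + inverse (real (Suc n)))"
proof -
  have z: "zs m n \<in> combos D" by (simp add: zs_def apx_combos[OF f])
  let ?q = "form K (zs m n) (zs m n)" and ?l = "lin (zs m n) f"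
  let ?a = "form K (apx f m) (zs m n)" and ?b = "form K (apx f n) (zs m n)"
  have eq: "?q = (?l - ?b) - (?l - ?a)" unfolding zs_def by simp
  have "?q\<^sup>2 \<le> 2 * ((?l - ?b)\<^sup>2 + (?l - ?a)\<^sup>2)"
    unfolding eq using sum_squares_ge_zero[of "(?l - ?b) + (?l - ?a)" 0]
    by (simp add: power2_eq_square algebra_simps)
  also have "\<dots> \<le> 2 * (inverse (real (Suc m)) + inverse (real (Suc n))) * ?q"
    using apx_error[OF f z, of m] apx_error[OF f z, of n] by (simp add: algebra_simps)
  finally show ?thesis
    using form_nonneg[OF z] by (cases "?q = 0") (auto simp: power2_eq_square)
qed

lemma apx_bounded:
  assumes f: "f \<in> rkhs_set D K"
  shows "\<exists>C. \<forall>n. form K (apx f n) (apx f n) \<le> C"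
proof -
  obtain C where C: "C \<ge> 0" "\<And>xs. xs \<in> combos D \<Longrightarrow> (lin xs f)\<^sup>2 \<le> C * form K xs xs"
    using rkhs_set_bound[OF f] by blast
  have "form K (apx f n) (apx f n) \<le> 2 * (C + 1)" for n
  proof -
    let ?x = "apx f n"
    let ?q = "form K ?x ?x" and ?l = "lin ?x f"
    have x: "?x \<in> combos D" by (rule apx_combos[OF f])
    have q: "?q \<ge> 0" by (rule form_nonneg[OF x])
    have "?q\<^sup>2 \<le> 2 * (?l\<^sup>2 + (?l - ?q)\<^sup>2)"
      using sum_squares_ge_zero[of "?l + (?l - ?q)" 0] by (simp add: power2_eq_square algebra_simps)
    also have "?l\<^sup>2 \<le> C * ?q" by (rule C(2)[OF x])
    also have "(?l - ?q)\<^sup>2 \<le> inverse (real (Suc n)) * ?q" by (rule apx_error[OF f x])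
    also have "\<dots> \<le> 1 * ?q" by (intro mult_right_mono q) (simp add: field_simps)
    finally have "?q\<^sup>2 \<le> 2 * (C + 1) * ?q" by (simp add: algebra_simps)
    then show ?thesis
      using q C(1) by (cases "?q = 0") (auto simp: power2_eq_square)
  qed
  then show ?thesis by blast
qed

text \<open>Evaluating g along the functionals that approximate f makes linearity in g immediate;
  symmetry comes from the two-sided description in \<open>rkhs_ip_form_tendsto\<close>.\<close>

definition rkhs_ip :: "('a \<Rightarrow> real) \<Rightarrow> ('a \<Rightarrow> real) \<Rightarrow> real" where
  "rkhs_ip f g = lim (\<lambda>n. lin (apx f n) g)"

lemma inverse_Suc_small: "e > 0 \<Longrightarrow> \<exists>N. \<forall>n\<ge>N. inverse (real (Suc n)) < e"
  using LIMSEQ_D[OF LIMSEQ_inverse_real_of_nat] by auto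

lemma rkhs_ip_tendsto:
  assumes f: "f \<in> rkhs_set D K" and g: "g \<in> rkhs_set D K"
  shows "(\<lambda>n. lin (apx f n) g) \<longlonglongrightarrow> rkhs_ip f g"
proof -
  obtain C where C: "C \<ge> 0" "\<And>xs. xs \<in> combos D \<Longrightarrow> (lin xs g)\<^sup>2 \<le> C * form K xs xs"
    using rkhs_set_bound[OF g] by blast
  have "Cauchy (\<lambda>n. lin (apx f n) g)"
  proof (rule CauchyI)
    fix e :: real assume e: "e > 0"
    \<comment> \<open>Chosen so that C d < e^2; the denominator C + 1 cannot vanish.\<close>
    define d where "d = e\<^sup>2 / (C + 1)"
    have quarters: "2 * (a + b) \<le> d" if "a < d / 4" "b < d / 4" for a b using that by simp
    have "d / 4 > 0" using e C(1) by (simp add: d_def)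
    from inverse_Suc_small[OF this]
    obtain N where N: "\<And>n. n \<ge> N \<Longrightarrow> inverse (real (Suc n)) < d / 4" by blast
    have "norm (lin (apx f m) g - lin (apx f n) g) < e" if "m \<ge> N" "n \<ge> N" for m n
    proof -
      let ?z = "apx f m @ scale (- 1) (apx f n)"
      have z: "?z \<in> combos D" by (simp add: apx_combos[OF f])
      have "(lin ?z g)\<^sup>2 \<le> C * form K ?z ?z" by (rule C(2)[OF z])
      also have "\<dots> \<le> C * (2 * (inverse (real (Suc m)) + inverse (real (Suc n))))"
        by (intro mult_left_mono apx_diff[OF f] C(1))
      also have "\<dots> \<le> C * d"
        by (intro mult_left_mono C(1) quarters N that)
      also have "\<dots> < e\<^sup>2" using e C(1) by (simp add: d_def field_simps)
      finally show ?thesis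
        using e by (simp add: abs_less_if_square_less)
    qed
    then show "\<exists>N. \<forall>m\<ge>N. \<forall>n\<ge>N. norm (lin (apx f m) g - lin (apx f n) g) < e" by blast
  qed
  then show ?thesis
    unfolding rkhs_ip_def by (simp add: Cauchy_convergent_iff convergent_LIMSEQ_iff)
qed

text \<open>The error bound is uniform over functionals of bounded form, so the test functional may
  move with n.\<close>

lemma apx_tendsto:
  assumes f: "f \<in> rkhs_set D K" and z: "\<And>n. Z n \<in> combos D"
    and bd: "\<And>n. form K (Z n) (Z n) \<le> C"
  shows "(\<lambda>n. lin (Z n) f - form K (apx f n) (Z n)) \<longlonglongrightarrow> 0"
proof -
  have "(\<lambda>n. (lin (Z n) f - form K (apx f n) (Z n))\<^sup>2) \<longlonglongrightarrow> 0"
  proof (rule tendsto_sandwich[OF _ _ tendsto_const])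
    show "\<forall>\<^sub>F n in sequentially.
        (lin (Z n) f - form K (apx f n) (Z n))\<^sup>2 \<le> inverse (real (Suc n)) * C"
    proof (intro always_eventually allI)
      fix n
      have "(lin (Z n) f - form K (apx f n) (Z n))\<^sup>2
          \<le> inverse (real (Suc n)) * form K (Z n) (Z n)" by (rule apx_error[OF f z])
      also have "\<dots> \<le> inverse (real (Suc n)) * C" by (intro mult_left_mono bd) simp
      finally show "(lin (Z n) f - form K (apx f n) (Z n))\<^sup>2 \<le> inverse (real (Suc n)) * C" .
    qed
    show "(\<lambda>n. inverse (real (Suc n)) * C) \<longlonglongrightarrow> 0"
      using tendsto_mult_right[OF LIMSEQ_inverse_real_of_nat, of C] by simp
  qed auto
  then have "(\<lambda>n. sqrt ((lin (Z n) f - form K (apx f n) (Z n))\<^sup>2)) \<longlonglongrightarrow> sqrt 0"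
    by (rule tendsto_real_sqrt)
  then show ?thesis by (simp add: tendsto_rabs_zero_iff)
qed

lemma rkhs_ip_form_tendsto:
  assumes f: "f \<in> rkhs_set D K" and g: "g \<in> rkhs_set D K"
  shows "(\<lambda>n. form K (apx f n) (apx g n)) \<longlonglongrightarrow> rkhs_ip f g"
proof -
  obtain C where C: "\<And>n. form K (apx f n) (apx f n) \<le> C" using apx_bounded[OF f] by blast
  have "(\<lambda>n. lin (apx f n) g - form K (apx g n) (apx f n)) \<longlonglongrightarrow> 0"
    by (rule apx_tendsto[OF g apx_combos[OF f] C])
  from tendsto_diff[OF rkhs_ip_tendsto[OF f g] this]
  show ?thesis
    by (simp add: form_commute[OF apx_combos[OF f] apx_combos[OF g]])
qed

lemma lin_apx_tendsto:
  assumes f: "f \<in> rkhs_set D K" and z: "zs \<in> combos D"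
  shows "(\<lambda>n. form K (apx f n) zs) \<longlonglongrightarrow> lin zs f"
  using tendsto_diff[OF tendsto_const[of "lin zs f"] apx_tendsto[OF f z order_refl]] by simp

lemma lin_le_ip:
  assumes f: "f \<in> rkhs_set D K" and z: "zs \<in> combos D"
  shows "(lin zs f)\<^sup>2 \<le> rkhs_ip f f * form K zs zs"
proof (rule LIMSEQ_le)
  show "(\<lambda>n. (form K (apx f n) zs)\<^sup>2) \<longlonglongrightarrow> (lin zs f)\<^sup>2"
    by (intro tendsto_power lin_apx_tendsto[OF f z])
  show "(\<lambda>n. form K (apx f n) (apx f n) * form K zs zs) \<longlonglongrightarrow> rkhs_ip f f * form K zs zs"
    by (intro tendsto_mult rkhs_ip_form_tendsto[OF f f] tendsto_const)
qed (use form_Cauchy_Schwarz[OF apx_combos[OF f] z] in blast)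

lemma rkhs_ip_nonneg:
  assumes f: "f \<in> rkhs_set D K"
  shows "0 \<le> rkhs_ip f f"
  by (rule LIMSEQ_le_const[OF rkhs_ip_form_tendsto[OF f f]])
    (use form_nonneg[OF apx_combos[OF f]] in auto)

text \<open>Testing the hypothesis on \<open>apx f n\<close> gives N^2 \<le> c N in the limit, where
  N is \<open>rkhs_ip f f\<close>. This converts estimates on finite functionals into norm
  estimates.\<close>

lemma ip_le:
  assumes f: "f \<in> rkhs_set D K" and "c \<ge> 0"
    and le: "\<And>zs. zs \<in> combos D \<Longrightarrow> (lin zs f)\<^sup>2 \<le> c * form K zs zs"
  shows "rkhs_ip f f \<le> c"
proof -
  have "(rkhs_ip f f)\<^sup>2 \<le> c * rkhs_ip f f"
  proof (rule LIMSEQ_le)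
    show "(\<lambda>n. (lin (apx f n) f)\<^sup>2) \<longlonglongrightarrow> (rkhs_ip f f)\<^sup>2"
      by (intro tendsto_power rkhs_ip_tendsto f)
    show "(\<lambda>n. c * form K (apx f n) (apx f n)) \<longlonglongrightarrow> c * rkhs_ip f f"
      by (intro tendsto_mult rkhs_ip_form_tendsto f tendsto_const)
  qed (use le[OF apx_combos[OF f]] in blast)
  then show ?thesis
    using rkhs_ip_nonneg[OF f] \<open>c \<ge> 0\<close> by (cases "rkhs_ip f f = 0") (auto simp: power2_eq_square)
qed

lemma rkhs_set_add:
  assumes "f \<in> rkhs_set D K" "g \<in> rkhs_set D K"
  shows "(\<lambda>x\<in>D. f x + g x) \<in> rkhs_set D K"
proof -
  obtain B where B: "B \<ge> 0" "\<And>xs. xs \<in> combos D \<Longrightarrow> (lin xs f)\<^sup>2 \<le> B * form K xs xs"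
    using rkhs_set_bound[OF assms(1)] by blast
  obtain C where C: "C \<ge> 0" "\<And>xs. xs \<in> combos D \<Longrightarrow> (lin xs g)\<^sup>2 \<le> C * form K xs xs"
    using rkhs_set_bound[OF assms(2)] by blast
  have "(lin xs (\<lambda>x\<in>D. f x + g x))\<^sup>2 \<le> (2 * (B + C)) * form K xs xs" if xs: "xs \<in> combos D" for xs
  proof -
    have "(lin xs f + lin xs g)\<^sup>2 \<le> 2 * ((lin xs f)\<^sup>2 + (lin xs g)\<^sup>2)"
      using sum_squares_ge_zero[of "lin xs f - lin xs g" 0]
      by (simp add: power2_eq_square algebra_simps)
    also have "\<dots> \<le> (2 * (B + C)) * form K xs xs"
      using B(2)[OF xs] C(2)[OF xs] by (simp add: algebra_simps)
    finally show ?thesis by (simp add: lin_restrict[OF xs] lin_add)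
  qed
  then show ?thesis by (intro rkhs_setI) simp_all
qed

lemma rkhs_set_scale:
  assumes "f \<in> rkhs_set D K"
  shows "(\<lambda>x\<in>D. c * f x) \<in> rkhs_set D K"
proof -
  obtain B where B: "B \<ge> 0" "\<And>xs. xs \<in> combos D \<Longrightarrow> (lin xs f)\<^sup>2 \<le> B * form K xs xs"
    using rkhs_set_bound[OF assms(1)] by blast
  have "(lin xs (\<lambda>x\<in>D. c * f x))\<^sup>2 \<le> (c\<^sup>2 * B) * form K xs xs" if xs: "xs \<in> combos D" for xs
    using mult_left_mono[OF B(2)[OF xs], of "c\<^sup>2"]
    by (simp add: lin_restrict[OF xs] lin_cmult power_mult_distrib mult.assoc)
  then show ?thesis by (intro rkhs_setI) simp_all
qed

lemma rkhs_set_diff: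
  assumes "f \<in> rkhs_set D K" "g \<in> rkhs_set D K"
  shows "(\<lambda>x\<in>D. f x - g x) \<in> rkhs_set D K"
proof -
  have "(\<lambda>x\<in>D. f x + (\<lambda>x\<in>D. - 1 * g x) x) = (\<lambda>x\<in>D. f x - g x)" by auto
  then show ?thesis using rkhs_set_add[OF assms(1) rkhs_set_scale[OF assms(2), of "-1"]] by simp
qed

lemma kernel_section_mem:
  assumes y: "y \<in> D"
  shows "(\<lambda>x\<in>D. K x y) \<in> rkhs_set D K"
proof -
  have "(lin xs (\<lambda>x\<in>D. K x y))\<^sup>2 \<le> K y y * form K xs xs" if xs: "xs \<in> combos D" for xs
    using form_Cauchy_Schwarz[OF xs, of "[(1, y)]"] y
    by (simp add: lin_restrict[OF xs] form_def mult.commute)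
  then show ?thesis by (intro rkhs_setI) simp_all
qed

lemma rkhs_ip_linear:
  assumes "f \<in> rkhs_set D K" "g \<in> rkhs_set D K" "h \<in> rkhs_set D K"
  shows rkhs_ip_add_right: "rkhs_ip f (\<lambda>x\<in>D. g x + h x) = rkhs_ip f g + rkhs_ip f h"
    and rkhs_ip_scale_right: "rkhs_ip f (\<lambda>x\<in>D. c * g x) = c * rkhs_ip f g"
proof -
  have "(\<lambda>n. lin (apx f n) (\<lambda>x\<in>D. g x + h x)) \<longlonglongrightarrow> rkhs_ip f g + rkhs_ip f h"
    unfolding lin_restrict[OF apx_combos[OF assms(1)]] lin_add
    by (intro tendsto_add rkhs_ip_tendsto assms)
  then show "rkhs_ip f (\<lambda>x\<in>D. g x + h x) = rkhs_ip f g + rkhs_ip f h"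
    by (rule LIMSEQ_unique[OF rkhs_ip_tendsto[OF assms(1) rkhs_set_add[OF assms(2,3)]]])
  have "(\<lambda>n. lin (apx f n) (\<lambda>x\<in>D. c * g x)) \<longlonglongrightarrow> c * rkhs_ip f g"
    unfolding lin_restrict[OF apx_combos[OF assms(1)]] lin_cmult
    by (intro tendsto_mult tendsto_const rkhs_ip_tendsto assms)
  then show "rkhs_ip f (\<lambda>x\<in>D. c * g x) = c * rkhs_ip f g"
    by (rule LIMSEQ_unique[OF rkhs_ip_tendsto[OF assms(1) rkhs_set_scale[OF assms(2)]]])
qed

lemma rkhs_ip_commute:
  assumes "f \<in> rkhs_set D K" "g \<in> rkhs_set D K"
  shows "rkhs_ip f g = rkhs_ip g f"
proof (rule LIMSEQ_unique[OF rkhs_ip_form_tendsto[OF assms]])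
  show "(\<lambda>n. form K (apx f n) (apx g n)) \<longlonglongrightarrow> rkhs_ip g f"
    using rkhs_ip_form_tendsto[OF assms(2,1)]
    by (simp add: form_commute[OF apx_combos[OF assms(1)] apx_combos[OF assms(2)]])
qed

lemma value_le_ip:
  assumes f: "f \<in> rkhs_set D K" and y: "y \<in> D"
  shows "(f y)\<^sup>2 \<le> rkhs_ip f f * K y y"
  using lin_le_ip[OF f, of "[(1, y)]"] y by (simp add: form_def)

text \<open>Point evaluations are bounded, so a Cauchy sequence converges pointwise. Its Cauchy
  estimates hold on every finite functional, survive the pointwise limit, and become norm estimates
  again through \<open>ip_le\<close>.\<close>

lemma rkhs_set_complete:
  assumes F: "\<And>n. F n \<in> rkhs_set D K"
    and cauchy: "\<forall>e>0. \<exists>N. \<forall>m\<ge>N. \<forall>n\<ge>N.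
          sqrt (rkhs_ip (\<lambda>x\<in>D. F m x - F n x) (\<lambda>x\<in>D. F m x - F n x)) < e"
  shows "\<exists>f\<in>rkhs_set D K.
    (\<lambda>n. sqrt (rkhs_ip (\<lambda>x\<in>D. F n x - f x) (\<lambda>x\<in>D. F n x - f x))) \<longlonglongrightarrow> 0"
proof -
  let ?d = "\<lambda>m n. rkhs_ip (\<lambda>x\<in>D. F m x - F n x) (\<lambda>x\<in>D. F m x - F n x)"
  have d_small: "\<exists>N. \<forall>m\<ge>N. \<forall>n\<ge>N. ?d m n < e" if "e > 0" for e
  proof -
    have "sqrt e > 0" using that by simp
    with cauchy have "\<exists>N. \<forall>m\<ge>N. \<forall>n\<ge>N. sqrt (?d m n) < sqrt e" by blast
    then show ?thesis by simp
  qed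
  have lin_d: "(lin zs (F m) - lin zs (F n))\<^sup>2 \<le> ?d m n * form K zs zs"
    if "zs \<in> combos D" for zs m n
    using lin_le_ip[OF rkhs_set_diff[OF F[of m] F[of n]] that]
    by (simp add: lin_restrict[OF that] lin_diff)
  have "convergent (\<lambda>n. F n y)" if y: "y \<in> D" for y
  proof -
    have "Cauchy (\<lambda>n. F n y)"
    proof (rule CauchyI)
      fix e :: real assume e: "e > 0"
      have Ky: "K y y \<ge> 0" using form_nonneg[of "[(1, y)]"] y by (simp add: form_def)
      then have "e\<^sup>2 / (K y y + 1) > 0" using e by (simp add: add_nonneg_pos)
      from d_small[OF this] obtain N
        where N: "\<And>m n. m \<ge> N \<Longrightarrow> n \<ge> N \<Longrightarrow> ?d m n < e\<^sup>2 / (K y y + 1)" by blast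
      have "norm (F m y - F n y) < e" if "m \<ge> N" "n \<ge> N" for m n
      proof -
        have "(F m y - F n y)\<^sup>2 \<le> ?d m n * K y y"
          using lin_d[of "[(1, y)]" m n] y by (simp add: form_def)
        also have "\<dots> \<le> e\<^sup>2 / (K y y + 1) * K y y"
          by (intro mult_right_mono Ky less_imp_le N that)
        also have "\<dots> < e\<^sup>2" using e Ky by (simp add: field_simps)
        finally show ?thesis using e by (simp add: abs_less_if_square_less)
      qed
      then show "\<exists>N. \<forall>m\<ge>N. \<forall>n\<ge>N. norm (F m y - F n y) < e" by blast
    qed
    then show ?thesis by (simp add: Cauchy_convergent_iff)
  qed
  then have lim: "(\<lambda>n. F n y) \<longlonglongrightarrow> lim (\<lambda>n. F n y)" if "y \<in> D" for y
    using that by (simp add: convergent_LIMSEQ_iff)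
  define f where "f = (\<lambda>y\<in>D. lim (\<lambda>n. F n y))"
  have pw: "(\<lambda>n. F n y) \<longlonglongrightarrow> f y" if "y \<in> D" for y
    using lim[OF that] that by (simp add: f_def)
  have bd: "(lin zs (F m) - lin zs f)\<^sup>2 \<le> e * form K zs zs"
    if N: "\<And>n. n \<ge> N \<Longrightarrow> ?d m n \<le> e" and z: "zs \<in> combos D" for zs m N e
  proof (rule LIMSEQ_le_const2)
    show "(\<lambda>n. (lin zs (F m) - lin zs (F n))\<^sup>2) \<longlonglongrightarrow> (lin zs (F m) - lin zs f)\<^sup>2"
      by (intro tendsto_power tendsto_diff tendsto_const tendsto_lin[OF z] pw)
    have "(lin zs (F m) - lin zs (F n))\<^sup>2 \<le> e * form K zs zs" if "n \<ge> N" for n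
      using lin_d[OF z, of m n] mult_right_mono[OF N[OF that] form_nonneg[OF z]] by linarith
    then show "\<exists>N. \<forall>n\<ge>N. (lin zs (F m) - lin zs (F n))\<^sup>2 \<le> e * form K zs zs" by blast
  qed
  have diff_mem: "(\<lambda>x\<in>D. F m x - f x) \<in> rkhs_set D K"
    if N: "\<And>n. n \<ge> N \<Longrightarrow> ?d m n \<le> e" for m N e
  proof -
    have "(lin zs (\<lambda>x\<in>D. F m x - f x))\<^sup>2 \<le> e * form K zs zs" if "zs \<in> combos D" for zs
      using bd[OF N that] by (simp add: lin_restrict[OF that] lin_diff)
    then show ?thesis by (intro rkhs_setI) simp_all
  qed
  obtain M where M: "\<And>m n. m \<ge> M \<Longrightarrow> n \<ge> M \<Longrightarrow> ?d m n \<le> 1"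
    using d_small[of 1] by (meson less_imp_le zero_less_one)
  \<comment> \<open>The limit f lies in the space as the difference of \<open>F M\<close> and
    \<open>F M\<close> minus f.\<close>
  have "(\<lambda>x\<in>D. F M x - (\<lambda>x\<in>D. F M x - f x) x) \<in> rkhs_set D K"
    by (rule rkhs_set_diff[OF F diff_mem[OF M[OF order_refl]]])
  also have "(\<lambda>x\<in>D. F M x - (\<lambda>x\<in>D. F M x - f x) x) = f" by (auto simp: f_def)
  finally have f: "f \<in> rkhs_set D K" .
  have "(\<lambda>n. sqrt (rkhs_ip (\<lambda>x\<in>D. F n x - f x) (\<lambda>x\<in>D. F n x - f x))) \<longlonglongrightarrow> 0"
  proof (rule LIMSEQ_I)
    fix r :: real assume r: "r > 0"
    then have "(r / 2)\<^sup>2 > 0" by simp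
    from d_small[OF this] obtain N
      where N: "\<And>m n. m \<ge> N \<Longrightarrow> n \<ge> N \<Longrightarrow> ?d m n \<le> (r / 2)\<^sup>2" by (meson less_imp_le)
    have "norm (sqrt (rkhs_ip (\<lambda>x\<in>D. F n x - f x) (\<lambda>x\<in>D. F n x - f x)) - 0) < r"
      if n: "n \<ge> N" for n
    proof -
      have mem: "(\<lambda>x\<in>D. F n x - f x) \<in> rkhs_set D K" by (rule rkhs_set_diff[OF F f])
      have "rkhs_ip (\<lambda>x\<in>D. F n x - f x) (\<lambda>x\<in>D. F n x - f x) \<le> (r / 2)\<^sup>2"
        by (rule ip_le[OF mem]) (use bd[OF N[OF n]] in \<open>auto simp: lin_restrict lin_diff\<close>)
      then have "sqrt (rkhs_ip (\<lambda>x\<in>D. F n x - f x) (\<lambda>x\<in>D. F n x - f x)) \<le> r / 2"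
        using r by (intro real_le_lsqrt) auto
      then show ?thesis using r rkhs_ip_nonneg[OF mem] by simp
    qed
    then show "\<exists>N. \<forall>n\<ge>N. norm (sqrt (rkhs_ip (\<lambda>x\<in>D. F n x - f x) (\<lambda>x\<in>D. F n x - f x)) - 0) < r"
      by blast
  qed
  then show ?thesis using f by blast
qed

theorem moore_aronszajn: "reproducing_kernel_hilbert_space D (rkhs_set D K) rkhs_ip K"
proof
  show "rkhs_set D K \<subseteq> extensional D" by (auto simp: rkhs_set_def)
  show "(\<lambda>x\<in>D. 0) \<in> rkhs_set D K"
    by (rule rkhs_setI[where C = 0]) (simp_all add: lin_restrict)
  show "rkhs_ip (\<lambda>x\<in>D. f x + g x) h = rkhs_ip f h + rkhs_ip g h"
    if "f \<in> rkhs_set D K" "g \<in> rkhs_set D K" "h \<in> rkhs_set D K" for f g h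
    using rkhs_ip_add_right[OF that(3,1,2)] rkhs_set_add[OF that(1,2)] that
    by (simp add: rkhs_ip_commute[of h])
  show "rkhs_ip (\<lambda>x\<in>D. c * f x) g = c * rkhs_ip f g"
    if "f \<in> rkhs_set D K" "g \<in> rkhs_set D K" for f g c
    using rkhs_ip_scale_right[OF that(2,1,1)] rkhs_set_scale[OF that(1)] that
    by (simp add: rkhs_ip_commute[of g])
  show "f = (\<lambda>x\<in>D. 0)" if f: "f \<in> rkhs_set D K" and "rkhs_ip f f = 0" for f
  proof (rule extensionalityI[of _ D])
    show "f \<in> extensional D" using f by (simp add: rkhs_set_def)
    show "f y = (\<lambda>x\<in>D. 0) y" if "y \<in> D" for y
      using value_le_ip[OF f that] \<open>rkhs_ip f f = 0\<close> that by simp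
  qed simp
  show "rkhs_ip f (\<lambda>x\<in>D. K x y) = f y" if f: "f \<in> rkhs_set D K" and y: "y \<in> D" for f y
  proof (rule LIMSEQ_unique[OF rkhs_ip_tendsto[OF f kernel_section_mem[OF y]]])
    show "(\<lambda>n. lin (apx f n) (\<lambda>x\<in>D. K x y)) \<longlonglongrightarrow> f y"
      using lin_apx_tendsto[OF f, of "[(1, y)]"] y
      by (simp add: lin_restrict[OF apx_combos[OF f]] form_def)
  qed
  show "\<exists>f\<in>rkhs_set D K.
      (\<lambda>n. sqrt (rkhs_ip (\<lambda>x\<in>D. F n x - f x) (\<lambda>x\<in>D. F n x - f x))) \<longlonglongrightarrow> 0"
    if "range F \<subseteq> rkhs_set D K" "\<forall>e>0. \<exists>N. \<forall>m\<ge>N. \<forall>n\<ge>N.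
      sqrt (rkhs_ip (\<lambda>x\<in>D. F m x - F n x) (\<lambda>x\<in>D. F m x - F n x)) < e" for F
    by (rule rkhs_set_complete[OF _ that(2)]) (use that(1) in blast)
qed (fact rkhs_set_add rkhs_set_scale rkhs_ip_commute rkhs_ip_nonneg kernel_section_mem)+

end

section \<open>Uniqueness of the carrier\<close>

context reproducing_kernel_hilbert_space
begin

lemma ip_add_right:
  "\<lbrakk>f \<in> H; g \<in> H; h \<in> H\<rbrakk> \<Longrightarrow> ip f (\<lambda>x\<in>D. g x + h x) = ip f g + ip f h"
  using ip_add_left[of g h f] ip_commute add_mem by simp

lemma ip_scale_right: "\<lbrakk>f \<in> H; g \<in> H\<rbrakk> \<Longrightarrow> ip f (\<lambda>x\<in>D. c * g x) = c * ip f g"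
  using ip_scale_left[of g f c] ip_commute scale_mem by simp

lemma ip_Cauchy_Schwarz:
  assumes "f \<in> H" "g \<in> H"
  shows "(ip f g)\<^sup>2 \<le> ip f f * ip g g"
proof (rule discriminant_bound)
  fix t
  let ?tg = "\<lambda>x\<in>D. t * g x"
  have tg: "?tg \<in> H" by (rule scale_mem[OF assms(2)])
  have "0 \<le> ip (\<lambda>x\<in>D. f x + ?tg x) (\<lambda>x\<in>D. f x + ?tg x)"
    by (rule ip_nonneg[OF add_mem[OF assms(1) tg]])
  also have "\<dots> = ip f f + ip f ?tg + (ip ?tg f + ip ?tg ?tg)"
    by (simp only: ip_add_left[OF assms(1) tg add_mem[OF assms(1) tg]]
        ip_add_right[OF assms(1) assms(1) tg] ip_add_right[OF tg assms(1) tg])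
  also have "\<dots> = ip f f + 2 * t * ip f g + t\<^sup>2 * ip g g"
    by (simp only: ip_scale_left[OF assms(2,1)] ip_scale_left[OF assms(2) tg]
        ip_scale_right[OF assms(1,2)] ip_scale_right[OF assms(2,2)] ip_commute[OF assms(2,1)])
      (simp add: power2_eq_square)
  finally show "0 \<le> ip f f + 2 * t * ip f g + t\<^sup>2 * ip g g" .
qed (rule ip_nonneg[OF assms(2)])

text \<open>The Riesz representer of \<open>lin xs\<close>, as \<open>kfun_mem_ip\<close>
  shows.\<close>

definition kfun :: "(real \<times> 'a) list \<Rightarrow> 'a \<Rightarrow> real" where
  "kfun xs = (\<lambda>x\<in>D. lin xs (K x))"

lemma kfun_mem_ip:
  assumes "xs \<in> combos D"
  shows "kfun xs \<in> H \<and> (\<forall>f\<in>H. ip f (kfun xs) = lin xs f)"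
  using assms
proof (induction xs)
  case Nil
  have "ip f (\<lambda>x\<in>D. 0) = 0" if "f \<in> H" for f
    using ip_scale_right[OF that that, of 0] by simp
  then show ?case using zero_mem by (simp add: kfun_def del: restrict_apply)
next
  case (Cons p xs)
  obtain c y where p: "p = (c, y)" by force
  then have y: "y \<in> D" and xs: "xs \<in> combos D" using Cons.prems by auto
  have IH: "kfun xs \<in> H" "\<And>f. f \<in> H \<Longrightarrow> ip f (kfun xs) = lin xs f" using Cons.IH[OF xs] by auto
  define k where "k = (\<lambda>x\<in>D. K x y)"
  define ck where "ck = (\<lambda>x\<in>D. c * k x)"
  have k: "k \<in> H" "\<And>f. f \<in> H \<Longrightarrow> ip f k = f y"
    unfolding k_def using kernel_mem reproducing y by blast+
  have ck: "ck \<in> H" "\<And>f. f \<in> H \<Longrightarrow> ip f ck = c * f y"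
    unfolding ck_def using k by (simp_all add: scale_mem ip_scale_right del: restrict_apply)
  have "kfun (p # xs) = (\<lambda>x\<in>D. ck x + kfun xs x)"
    by (auto simp: kfun_def ck_def k_def p)
  then show ?case
    using ck IH add_mem[OF ck(1) IH(1)] ip_add_right[OF _ ck(1) IH(1)]
    by (simp add: p del: restrict_apply)
qed

lemmas kfun_mem = kfun_mem_ip[THEN conjunct1]
  and ip_kfun = kfun_mem_ip[THEN conjunct2, rule_format]

lemma ip_kfun_kfun:
  assumes "xs \<in> combos D" "ys \<in> combos D"
  shows "ip (kfun xs) (kfun ys) = form K ys xs"
  using ip_kfun[OF assms(2) kfun_mem[OF assms(1)]]
  by (simp add: kfun_def lin_restrict[OF assms(2)] form_def)

lemma psd_kernel_K: "psd_kernel D K"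
proof
  show "K x y = K y x" if "x \<in> D" "y \<in> D" for x y
    using ip_commute[OF kernel_mem kernel_mem, OF that] reproducing[OF kernel_mem, OF that]
      reproducing[OF kernel_mem, OF that(2,1)] that by simp
  show "0 \<le> form K xs xs" if "xs \<in> combos D" for xs
    using ip_nonneg[OF kfun_mem[OF that]] ip_kfun_kfun[OF that that] by simp
qed

text \<open>Elements of H satisfy the criterion by Cauchy-Schwarz against the representers.
  Conversely, the representers of \<open>apx f n\<close> form a Cauchy sequence in H, and its limit
  takes the values of f because evaluations are continuous on H.\<close>

lemma carrier_eq_rkhs_set: "H = rkhs_set D K"
proof (intro equalityI subsetI)
  fix f assume f: "f \<in> H"
  have "(lin xs f)\<^sup>2 \<le> ip f f * form K xs xs" if "xs \<in> combos D" for xs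
    using ip_Cauchy_Schwarz[OF f kfun_mem[OF that]]
    by (simp add: ip_kfun[OF that f] ip_kfun_kfun[OF that that])
  then show "f \<in> rkhs_set D K" using f extensional by (auto simp: rkhs_set_def)
next
  interpret psd_kernel D K by (rule psd_kernel_K)
  fix f assume f: "f \<in> rkhs_set D K"
  define F where "F n = kfun (apx f n)" for n
  have diff: "(\<lambda>x\<in>D. F m x - F n x) = kfun (apx f m @ scale (- 1) (apx f n))" for m n
    by (auto simp: F_def kfun_def)
  have FH: "F n \<in> H" for n by (simp add: F_def kfun_mem apx_combos[OF f])
  have "\<exists>g\<in>H. (\<lambda>n. sqrt (ip (\<lambda>x\<in>D. F n x - g x) (\<lambda>x\<in>D. F n x - g x))) \<longlonglongrightarrow> 0"
  proof (rule complete)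
    show "range F \<subseteq> H" using FH by blast
    show "\<forall>e>0. \<exists>N. \<forall>m\<ge>N. \<forall>n\<ge>N.
          sqrt (ip (\<lambda>x\<in>D. F m x - F n x) (\<lambda>x\<in>D. F m x - F n x)) < e"
    proof (intro allI impI)
      fix e :: real assume e: "e > 0"
      then have "e\<^sup>2 / 4 > 0" by simp
      from inverse_Suc_small[OF this]
      obtain N where N: "\<And>n. n \<ge> N \<Longrightarrow> inverse (real (Suc n)) < e\<^sup>2 / 4" by blast
      have "sqrt (ip (\<lambda>x\<in>D. F m x - F n x) (\<lambda>x\<in>D. F m x - F n x)) < e"
        if "m \<ge> N" "n \<ge> N" for m n
      proof -
        let ?z = "apx f m @ scale (- 1) (apx f n)"
        have "?z \<in> combos D" by (simp add: apx_combos[OF f])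
        then have "ip (\<lambda>x\<in>D. F m x - F n x) (\<lambda>x\<in>D. F m x - F n x) = form K ?z ?z"
          unfolding diff by (intro ip_kfun_kfun)
        also have "\<dots> \<le> 2 * (inverse (real (Suc m)) + inverse (real (Suc n)))"
          by (rule apx_diff[OF f])
        also have "\<dots> < e\<^sup>2" using N[OF that(1)] N[OF that(2)] by simp
        finally show ?thesis using e by (simp add: real_less_lsqrt)
      qed
      then show "\<exists>N. \<forall>m\<ge>N. \<forall>n\<ge>N.
          sqrt (ip (\<lambda>x\<in>D. F m x - F n x) (\<lambda>x\<in>D. F m x - F n x)) < e" by blast
    qed
  qed
  then obtain g where g: "g \<in> H"
    and lim: "(\<lambda>n. sqrt (ip (\<lambda>x\<in>D. F n x - g x) (\<lambda>x\<in>D. F n x - g x))) \<longlonglongrightarrow> 0" by blast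
  have "f = g"
  proof (rule extensionalityI[of _ D])
    show "f \<in> extensional D" using f by (simp add: rkhs_set_def)
    show "g \<in> extensional D" using g extensional by blast
    fix y assume y: "y \<in> D"
    have Fy: "F n y = form K (apx f n) [(1, y)]" for n
      using y by (simp add: F_def kfun_def form_def lin_cong[OF apx_combos[OF f] kernel_sym[OF y]])
    have "(\<lambda>n. F n y) \<longlonglongrightarrow> f y"
      using lin_apx_tendsto[OF f, of "[(1, y)]"] y by (simp add: Fy)
    moreover have "(\<lambda>n. F n y) \<longlonglongrightarrow> g y"
    proof (rule LIM_zero_cancel, rule Lim_null_comparison)
      show "(\<lambda>n. sqrt (ip (\<lambda>x\<in>D. F n x - g x) (\<lambda>x\<in>D. F n x - g x)) * sqrt (K y y)) \<longlonglongrightarrow> 0"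
        using tendsto_mult_right[OF lim] by simp
      have "norm (F n y - g y)
          \<le> sqrt (ip (\<lambda>x\<in>D. F n x - g x) (\<lambda>x\<in>D. F n x - g x)) * sqrt (K y y)" for n
      proof -
        let ?d = "\<lambda>x\<in>D. F n x - g x"
        have "?d = (\<lambda>x\<in>D. F n x + (\<lambda>x\<in>D. - 1 * g x) x)" by auto
        then have d: "?d \<in> H" using add_mem[OF FH scale_mem[OF g]] by metis
        have "(?d y)\<^sup>2 \<le> ip ?d ?d * K y y"
          using ip_Cauchy_Schwarz[OF d kernel_mem[OF y]] reproducing[OF d y]
            reproducing[OF kernel_mem[OF y] y] y by simp
        then have "sqrt ((?d y)\<^sup>2) \<le> sqrt (ip ?d ?d * K y y)" by (rule real_sqrt_le_mono)
        then show ?thesis using y by (simp add: real_sqrt_mult)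
      qed
      then show "\<forall>\<^sub>F n in sequentially. norm (F n y - g y)
          \<le> sqrt (ip (\<lambda>x\<in>D. F n x - g x) (\<lambda>x\<in>D. F n x - g x)) * sqrt (K y y)" by simp
    qed
    ultimately show "f y = g y" by (rule LIMSEQ_unique)
  qed
  then show "f \<in> H" using g by simp
qed

end

theorem RKHS_eq_rkhs_set:
  assumes "psd_kernel D K"
  shows "RKHS D K = rkhs_set D K"
  unfolding RKHS_def
proof (rule the_equality)
  interpret psd_kernel D K by (rule assms)
  show "\<exists>ip. reproducing_kernel_hilbert_space D (rkhs_set D K) ip K"
    using moore_aronszajn by blast
qed (use reproducing_kernel_hilbert_space.carrier_eq_rkhs_set in blast)

section \<open>Products and domination of kernels\<close>

lemma psd_kernel_subset:
  assumes "psd_kernel D K" "E \<subseteq> D"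
  shows "psd_kernel E K"
  using assms unfolding psd_kernel_def combos_def by blast

lemma psd_kernel_pullback:
  assumes "psd_kernel E K" "\<And>x. x \<in> D \<Longrightarrow> h x \<in> E"
  shows "psd_kernel D (\<lambda>x y. K (h x) (h y))"
proof -
  interpret psd_kernel E K by fact
  show ?thesis
  proof
    fix xs assume xs: "xs \<in> combos D"
    have "form (\<lambda>x y. K (h x) (h y)) xs xs
        = form K (map (\<lambda>(c, x). (c * 1, h x)) xs) (map (\<lambda>(c, x). (c * 1, h x)) xs)"
      by (simp add: form_def lin_map[where g = "\<lambda>_. 1", simplified])
    also have "\<dots> \<ge> 0" by (intro form_nonneg combos_map[OF xs] assms(2))
    finally show "0 \<le> form (\<lambda>x y. K (h x) (h y)) xs xs" .
  qed (use assms(2) kernel_sym in blast)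
qed

lemma psd_kernel_rank_one: "psd_kernel D (\<lambda>x y. f x * f y)"
  by unfold_locales (simp_all add: form_rank_one)

lemma psd_kernel_const: "0 \<le> c \<Longrightarrow> psd_kernel D (\<lambda>x y. c)"
  using psd_kernel_rank_one[of D "\<lambda>_. sqrt c"] by simp

lemma psd_kernel_add:
  assumes "psd_kernel D K" "psd_kernel D L"
  shows "psd_kernel D (\<lambda>x y. K x y + L x y)"
  using assms by (simp add: psd_kernel_def form_add)

lemma psd_kernel_cmult:
  assumes "psd_kernel D K" "0 \<le> c"
  shows "psd_kernel D (\<lambda>x y. c * K x y)"
  using assms by (simp add: psd_kernel_def form_cmult)

lemma psd_kernel_sum:
  assumes "\<And>i. i \<in> I \<Longrightarrow> psd_kernel D (M i)"
  shows "psd_kernel D (\<lambda>x y. \<Sum>i\<in>I. M i x y)"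
  using assms unfolding psd_kernel_def by (auto simp: form_sum intro!: sum_nonneg sum.cong)

lemma psd_kernel_sums:
  assumes "\<And>n. psd_kernel D (F n)"
    and "\<And>x y. x \<in> D \<Longrightarrow> y \<in> D \<Longrightarrow> (\<lambda>n. F n x y) sums K x y"
  shows "psd_kernel D K"
proof
  show "K x y = K y x" if "x \<in> D" "y \<in> D" for x y
    using sums_unique2[OF assms(2)[OF that]] assms(2)[OF that(2,1)] assms(1) that
    by (simp add: psd_kernel_def)
  show "0 \<le> form K xs xs" if "xs \<in> combos D" for xs
    by (rule sums_le[OF _ sums_zero sums_form[OF that that assms(2)]])
      (use assms(1) that in \<open>auto simp: psd_kernel_def\<close>)
qed

text \<open>Cholesky: splitting off the rank one kernel \<open>K(x,p) K(y,p) / K(p,p)\<close> leaves a positive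
  semidefinite kernel that vanishes at \<open>p\<close>. (If \<open>K(p,p) = 0\<close> then \<open>K(\<cdot>,p) = 0\<close>, and
  \<open>0 / 0 = 0\<close> is the right value.)\<close>

lemma finite_features:
  assumes "finite F" "psd_kernel F K"
  shows "\<exists>n (\<phi> :: nat \<Rightarrow> 'a \<Rightarrow> real). \<forall>x\<in>F. \<forall>y\<in>F. K x y = (\<Sum>i<n. \<phi> i x * \<phi> i y)"
  using assms
proof (induction F arbitrary: K rule: finite_induct)
  case (insert p F)
  interpret psd_kernel "insert p F" K by fact
  let ?p = "[(1, p)]"
  have CS: "(lin xs (\<lambda>x. K x p))\<^sup>2 \<le> form K xs xs * K p p" if "xs \<in> combos (insert p F)" for xs
    using form_Cauchy_Schwarz[OF that, of ?p] by (simp add: form_def)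
  have Kpp: "0 \<le> K p p" using form_nonneg[of ?p] by (simp add: form_def)
  define L where "L x y = K x y - K x p * K y p / K p p" for x y
  have L_psd: "psd_kernel (insert p F) L"
  proof
    show "L x y = L y x" if "x \<in> insert p F" "y \<in> insert p F" for x y
      using kernel_sym[OF that] by (simp add: L_def)
    fix xs assume xs: "xs \<in> combos (insert p F)"
    have "form L xs xs = form K xs xs - inverse (K p p) * (lin xs (\<lambda>x. K x p))\<^sup>2"
      by (simp add: L_def[abs_def] form_diff form_rank_one[symmetric] form_cmult[symmetric]
          divide_inverse mult.commute)
    also have "\<dots> \<ge> 0"
      using CS[OF xs] Kpp form_nonneg[OF xs]
      by (cases "K p p = 0") (auto simp: field_simps)
    finally show "0 \<le> form L xs xs" .
  qed
  have Kxp: "K x p = 0" if "x \<in> insert p F" "K p p = 0" for x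
    using CS[of "[(1, x)]"] that by simp
  have Lp: "L x p = 0" "L p x = 0" if "x \<in> insert p F" for x
    using Kxp[OF that] kernel_sym[OF that, of p] by (cases "K p p = 0"; simp add: L_def)+
  obtain n and \<phi> :: "nat \<Rightarrow> 'a \<Rightarrow> real"
    where IH: "\<And>x y. x \<in> F \<Longrightarrow> y \<in> F \<Longrightarrow> L x y = (\<Sum>i<n. \<phi> i x * \<phi> i y)"
    using insert.IH[OF psd_kernel_subset[OF L_psd]] by blast
  \<comment> \<open>The features \<open>\<phi>\<close> are controlled on F only. Since
    \<open>L\<close> vanishes at p, they are replaced by zero there.\<close>
  define \<psi> where "\<psi> i x = (if i = n then K x p / sqrt (K p p) else if x = p then 0 else \<phi> i x)"
    for i x
  have "K x y = (\<Sum>i<Suc n. \<psi> i x * \<psi> i y)" if "x \<in> insert p F" "y \<in> insert p F" for x y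
  proof -
    have "(\<Sum>i<n. \<psi> i x * \<psi> i y) = L x y"
    proof (cases "x = p \<or> y = p")
      case True
      then show ?thesis using Lp that by (auto simp: \<psi>_def intro!: sum.neutral)
    next
      case False
      then show ?thesis using IH[of x y] that by (auto simp: \<psi>_def intro!: sum.cong)
    qed
    then show ?thesis using Kpp by (simp add: \<psi>_def L_def)
  qed
  then show ?case by blast
qed auto

text \<open>A list sees only finitely many points, so K may be replaced by a finite sum of products
  of features. Each feature is absorbed into the coefficients, which leaves a form of L.\<close>

theorem Schur_product:
  assumes "psd_kernel D K" "psd_kernel D L"
  shows "psd_kernel D (\<lambda>x y. K x y * L x y)"
proof
  show "K x y * L x y = K y x * L y x" if "x \<in> D" "y \<in> D" for x y
    using assms that by (simp add: psd_kernel_def)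
  fix xs assume xs: "xs \<in> combos D"
  define F where "F = snd ` set xs"
  have xsF: "xs \<in> combos F" by (simp add: F_def combos_def)
  have "F \<subseteq> D" using xs by (simp add: F_def combos_def)
  obtain n and \<phi> :: "nat \<Rightarrow> 'a \<Rightarrow> real"
    where \<phi>: "\<And>x y. x \<in> F \<Longrightarrow> y \<in> F \<Longrightarrow> K x y = (\<Sum>i<n. \<phi> i x * \<phi> i y)"
    using finite_features[of F K] psd_kernel_subset[OF assms(1) \<open>F \<subseteq> D\<close>] by (auto simp: F_def)
  let ?xs = "\<lambda>i. map (\<lambda>(c, x). (c * \<phi> i x, x)) xs"
  have "form (\<lambda>x y. K x y * L x y) xs xs
      = form (\<lambda>x y. \<Sum>i<n. \<phi> i x * (\<phi> i y * L x y)) xs xs"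
    by (rule form_cong[OF xsF xsF]) (simp add: \<phi> sum_distrib_right mult.assoc)
  also have "\<dots> = (\<Sum>i<n. form L (?xs i) (?xs i))"
    by (simp add: form_sum) (simp add: form_def lin_map[where h = "\<lambda>x. x"] lin_cmult)
  also have "\<dots> \<ge> 0"
    using assms(2) combos_map[OF xs, of "\<lambda>x. x"]
    by (intro sum_nonneg) (simp add: psd_kernel_def)
  finally show "0 \<le> form (\<lambda>x y. K x y * L x y) xs xs" .
qed

lemma psd_kernel_prod:
  assumes "\<And>i. i \<in> I \<Longrightarrow> psd_kernel D (M i)"
  shows "psd_kernel D (\<lambda>x y. \<Prod>i\<in>I. M i x y)"
  using assms
  by (induction I rule: infinite_finite_induct) (auto intro!: psd_kernel_const Schur_product)

text \<open>Telescoping: N N' - M M' = N (N' - M') + (N - M) M', where every factor is positive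
  semidefinite.\<close>

lemma psd_kernel_prod_diff:
  assumes "\<And>i. i \<in> I \<Longrightarrow> psd_kernel D (M i)"
    and "\<And>i. i \<in> I \<Longrightarrow> psd_kernel D (\<lambda>x y. N i x y - M i x y)"
  shows "psd_kernel D (\<lambda>x y. (\<Prod>i\<in>I. N i x y) - (\<Prod>i\<in>I. M i x y))"
  using assms
proof (induction I rule: infinite_finite_induct)
  case (insert i I)
  have "psd_kernel D (\<lambda>x y. M i x y + (N i x y - M i x y))"
    by (intro psd_kernel_add insert.prems) auto
  then have "psd_kernel D (N i)" by simp
  then have "psd_kernel D (\<lambda>x y. N i x y * ((\<Prod>i\<in>I. N i x y) - (\<Prod>i\<in>I. M i x y))
      + (N i x y - M i x y) * (\<Prod>i\<in>I. M i x y))"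
    using insert by (intro psd_kernel_add Schur_product psd_kernel_prod) auto
  also have "(\<lambda>x y. N i x y * ((\<Prod>i\<in>I. N i x y) - (\<Prod>i\<in>I. M i x y))
      + (N i x y - M i x y) * (\<Prod>i\<in>I. M i x y))
      = (\<lambda>x y. (\<Prod>i\<in>insert i I. N i x y) - (\<Prod>i\<in>insert i I. M i x y))"
    using insert.hyps by (intro ext) (simp add: algebra_simps)
  finally show ?case .
qed (simp_all add: psd_kernel_const)

section \<open>From domination of kernels to membership and inclusion\<close>

lemma rkhs_set_mono:
  assumes "psd_kernel D K" "psd_kernel D (\<lambda>x y. c * L x y - K x y)"
  shows "rkhs_set D K \<subseteq> rkhs_set D L"
proof
  fix f assume f: "f \<in> rkhs_set D K"
  then obtain C where C: "C \<ge> 0" "\<And>xs. xs \<in> combos D \<Longrightarrow> (lin xs f)\<^sup>2 \<le> C * form K xs xs"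
    using psd_kernel.rkhs_set_bound[OF assms(1)] by blast
  have "(lin xs f)\<^sup>2 \<le> (C * c) * form L xs xs" if xs: "xs \<in> combos D" for xs
  proof -
    have "form K xs xs \<le> c * form L xs xs"
      using psd_kernel.form_nonneg[OF assms(2) xs] by (simp add: form_diff form_cmult)
    from mult_left_mono[OF this C(1)] show ?thesis using C(2)[OF xs] by (simp add: mult.assoc)
  qed
  moreover have "f \<in> extensional D" using f by (simp add: rkhs_set_def)
  ultimately show "f \<in> rkhs_set D L" by (rule rkhs_setI[rotated])
qed

text \<open>Here the dominated kernel is f(x) f(y), whose space is the line spanned by f.\<close>

lemma rank_one_mem_rkhs_set:
  assumes "psd_kernel D (\<lambda>x y. c * L x y - f x * f y)"
  shows "(\<lambda>x\<in>D. f x) \<in> rkhs_set D L"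
proof (rule rkhs_setI)
  fix xs assume xs: "xs \<in> combos D"
  show "(lin xs (\<lambda>x\<in>D. f x))\<^sup>2 \<le> c * form L xs xs"
    using psd_kernel.form_nonneg[OF assms xs]
    by (simp add: lin_restrict[OF xs] form_diff form_cmult form_rank_one)
qed simp

section \<open>Weighted tensor products\<close>

text \<open>The constant stands in front to match the factors in \<open>weighted_kernel\<close>.
  What remains of the two univariate kernels has integral zero in each variable.\<close>

abbreviation mean_zero_part :: "(real \<Rightarrow> real \<Rightarrow> real) \<Rightarrow> real \<Rightarrow> real \<Rightarrow> real" where
  "mean_zero_part k x y \<equiv> - 1 + k x y"

lemma psd_kernel_coordinate:
  assumes "psd_kernel {0..1} K"
  shows "psd_kernel unit_cube (\<lambda>x y. K (x $ j) (y $ j))"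
  using assms by (rule psd_kernel_pullback) (simp add: unit_cube_def)

lemma psd_weighted_kernel:
  fixes \<gamma> :: "'s::finite set \<Rightarrow> real"
  assumes "psd_kernel {0..1} (mean_zero_part k)" "\<And>u. \<gamma> u \<ge> 0"
  shows "psd_kernel unit_cube (weighted_kernel k \<gamma>)"
proof -
  have "psd_kernel unit_cube
      (\<lambda>x y. 1 + (\<Sum>u | u \<noteq> {}. \<gamma> u * (\<Prod>j\<in>u. mean_zero_part k (x $ j) (y $ j))))"
    using assms(2)
    by (intro psd_kernel_add psd_kernel_const psd_kernel_sum psd_kernel_cmult psd_kernel_prod
        psd_kernel_coordinate[OF assms(1)]) auto
  then show ?thesis by (simp add: weighted_kernel_def[abs_def])
qed

text \<open>The product over a set u is dominated with constant C^|u|. As C \<ge> 1, the single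
  constant C^s serves all u, and the surplus C^s - C^|u| multiplies a positive semidefinite
  kernel.\<close>

lemma psd_weighted_kernel_diff:
  fixes \<gamma> :: "'s::finite set \<Rightarrow> real"
  assumes "psd_kernel {0..1} (mean_zero_part k)" "psd_kernel {0..1} (mean_zero_part l)"
    and dom: "psd_kernel {0..1} (\<lambda>x y. C * mean_zero_part l x y - mean_zero_part k x y)"
    and "C \<ge> 1" and \<gamma>: "\<And>u. \<gamma> u \<ge> 0"
  shows "psd_kernel unit_cube
    (\<lambda>x y. C ^ CARD('s) * weighted_kernel l \<gamma> x y - weighted_kernel k \<gamma> x y)"
proof -
  define P where "P m u x y = (\<Prod>j\<in>u. mean_zero_part m (x $ j) (y $ j))"
    for m :: "real \<Rightarrow> real \<Rightarrow> real" and u :: "'s set" and x y :: "real ^ 's"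
  have wP: "weighted_kernel m \<gamma> x y = 1 + (\<Sum>u | u \<noteq> {}. \<gamma> u * P m u x y)" for m x y
    by (simp add: weighted_kernel_def P_def)
  let ?M = "C ^ CARD('s)"
  have card: "C ^ card u \<le> ?M" for u :: "'s set"
    using \<open>C \<ge> 1\<close> by (intro power_increasing card_mono) auto
  have "psd_kernel unit_cube (\<lambda>x y. C ^ card u * P l u x y - P k u x y)" for u
    using psd_kernel_prod_diff[of u unit_cube
        "\<lambda>j x y. mean_zero_part k (x $ j) (y $ j)" "\<lambda>j x y. C * mean_zero_part l (x $ j) (y $ j)"]
      psd_kernel_coordinate[OF assms(1)] psd_kernel_coordinate[OF dom]
    unfolding P_def prod.distrib prod_constant by blast
  moreover have "psd_kernel unit_cube (P l u)" for u
    unfolding P_def by (intro psd_kernel_prod psd_kernel_coordinate assms(2))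
  ultimately have "psd_kernel unit_cube (\<lambda>x y. (?M - 1) + (\<Sum>u | u \<noteq> {}. \<gamma> u *
      ((?M - C ^ card u) * P l u x y + (C ^ card u * P l u x y - P k u x y))))"
    using \<open>C \<ge> 1\<close> \<gamma> card
    by (intro psd_kernel_add psd_kernel_const psd_kernel_sum psd_kernel_cmult) auto
  also have "(\<lambda>x y. (?M - 1) + (\<Sum>u | u \<noteq> {}. \<gamma> u *
      ((?M - C ^ card u) * P l u x y + (C ^ card u * P l u x y - P k u x y))))
      = (\<lambda>x y. ?M * weighted_kernel l \<gamma> x y - weighted_kernel k \<gamma> x y)"
    by (intro ext) (simp add: wP algebra_simps sum_distrib_left sum.distrib sum_subtractf)
  finally show ?thesis .
qed

lemma product_mem_weighted:
  fixes \<gamma> :: "'s::finite set \<Rightarrow> real"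
  assumes psd: "psd_kernel {0..1} (mean_zero_part k)" and \<gamma>: "\<And>u. \<gamma> u \<ge> 0"
    and u: "u \<noteq> {}" "\<gamma> u > 0"
    and dom: "psd_kernel {0..1} (\<lambda>x y. C * mean_zero_part k x y - f x * f y)"
  shows "(\<lambda>x\<in>unit_cube. \<Prod>j\<in>u. f (x $ j)) \<in> rkhs_set unit_cube (weighted_kernel k \<gamma>)"
proof (rule rank_one_mem_rkhs_set)
  define P where "P v x y = (\<Prod>j\<in>v. mean_zero_part k (x $ j) (y $ j))"
    for v :: "'s set" and x y :: "real ^ 's"
  have P: "psd_kernel unit_cube (P v)" for v
    unfolding P_def by (intro psd_kernel_prod psd_kernel_coordinate psd)
  \<comment> \<open>The absolute value supplies the sign that the hypothesis on C leaves open;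
    dividing by \<open>\<gamma> u\<close> matches the summand of u in the weighted kernel.\<close>
  let ?c = "\<bar>C\<bar> ^ card u / \<gamma> u"
  have "psd_kernel {0..1} (\<lambda>x y. (\<bar>C\<bar> - C) * mean_zero_part k x y
      + (C * mean_zero_part k x y - f x * f y))"
    by (intro psd_kernel_add psd_kernel_cmult psd dom) auto
  also have "(\<lambda>x y. (\<bar>C\<bar> - C) * mean_zero_part k x y + (C * mean_zero_part k x y - f x * f y))
      = (\<lambda>x y. \<bar>C\<bar> * mean_zero_part k x y - f x * f y)"
    by (intro ext) (simp add: algebra_simps)
  finally have "psd_kernel unit_cube (\<lambda>x y. \<bar>C\<bar> ^ card u * P u x y
      - (\<Prod>j\<in>u. f (x $ j)) * (\<Prod>j\<in>u. f (y $ j)))"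
    using psd_kernel_prod_diff[of u unit_cube
        "\<lambda>j x y. f (x $ j) * f (y $ j)" "\<lambda>j x y. \<bar>C\<bar> * mean_zero_part k (x $ j) (y $ j)"]
      psd_kernel_coordinate[OF psd_kernel_rank_one[of _ f]] psd_kernel_coordinate
    unfolding P_def prod.distrib prod_constant by blast
  then have "psd_kernel unit_cube (\<lambda>x y. ?c * 1 + (?c * (\<Sum>v\<in>{v. v \<noteq> {}} - {u}. \<gamma> v * P v x y)
      + (\<bar>C\<bar> ^ card u * P u x y - (\<Prod>j\<in>u. f (x $ j)) * (\<Prod>j\<in>u. f (y $ j)))))"
    using \<gamma> P by (intro psd_kernel_add psd_kernel_cmult psd_kernel_sum psd_kernel_const) auto
  also have "(\<lambda>x y. ?c * 1 + (?c * (\<Sum>v\<in>{v. v \<noteq> {}} - {u}. \<gamma> v * P v x y)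
      + (\<bar>C\<bar> ^ card u * P u x y - (\<Prod>j\<in>u. f (x $ j)) * (\<Prod>j\<in>u. f (y $ j)))))
      = (\<lambda>x y. ?c * weighted_kernel k \<gamma> x y - (\<Prod>j\<in>u. f (x $ j)) * (\<Prod>j\<in>u. f (y $ j)))"
  proof (intro ext)
    fix x y
    have "weighted_kernel k \<gamma> x y
        = 1 + (\<gamma> u * P u x y + (\<Sum>v\<in>{v. v \<noteq> {}} - {u}. \<gamma> v * P v x y))"
      using u sum.remove[of "{v. v \<noteq> {}}" u "\<lambda>v. \<gamma> v * P v x y"]
      by (simp add: weighted_kernel_def P_def)
    then show "?c * 1 + (?c * (\<Sum>v\<in>{v. v \<noteq> {}} - {u}. \<gamma> v * P v x y)
      + (\<bar>C\<bar> ^ card u * P u x y - (\<Prod>j\<in>u. f (x $ j)) * (\<Prod>j\<in>u. f (y $ j))))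
      = ?c * weighted_kernel k \<gamma> x y - (\<Prod>j\<in>u. f (x $ j)) * (\<Prod>j\<in>u. f (y $ j))"
      using u by (simp add: field_simps)
  qed
  finally show "psd_kernel unit_cube (\<lambda>x y. ?c * weighted_kernel k \<gamma> x y
      - (\<Prod>j\<in>u. f (x $ j)) * (\<Prod>j\<in>u. f (y $ j)))" .
qed

text \<open>Functionals supported on the \<open>j\<close>-th coordinate axis reduce the claim to one variable;
  annihilating constants removes all weights of sets that do not contain \<open>j\<close>.\<close>

lemma product_not_mem_weighted:
  fixes \<gamma> :: "'s::finite set \<Rightarrow> real"
  assumes psd: "psd_kernel {0..1} (mean_zero_part k)" and \<gamma>: "\<And>u. \<gamma> u \<ge> 0"
    and "u \<noteq> {}" and "f 0 \<noteq> 0"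
    and small: "\<And>e. e > 0 \<Longrightarrow> \<exists>xs\<in>combos {0..1}. lin xs (\<lambda>_. 1) = 0 \<and>
      form (mean_zero_part k) xs xs < e * (lin xs f)\<^sup>2"
  shows "(\<lambda>x\<in>unit_cube. \<Prod>j\<in>u. f (x $ j)) \<notin> rkhs_set unit_cube (weighted_kernel k \<gamma>)"
proof
  let ?h = "\<lambda>x. \<Prod>j\<in>u. f (x $ j)" and ?K = "weighted_kernel k \<gamma>" and ?\<kappa> = "mean_zero_part k"
  assume "(\<lambda>x\<in>unit_cube. ?h x) \<in> rkhs_set unit_cube ?K"
  then obtain C where C: "C \<ge> 0"
    "\<And>ys. ys \<in> combos unit_cube \<Longrightarrow> (lin ys (\<lambda>x\<in>unit_cube. ?h x))\<^sup>2 \<le> C * form ?K ys ys"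
    using psd_kernel.rkhs_set_bound[OF psd_weighted_kernel[OF psd, of \<gamma>]] \<gamma> by blast
  obtain j where j: "j \<in> u" using \<open>u \<noteq> {}\<close> by blast
  define E where "E t = (\<chi> i. if i = j then t else 0)" for t :: real
  \<comment> \<open>The coordinates in u other than j are frozen at 0 and contribute this factor,
    which is nonzero because \<open>f 0 \<noteq> 0\<close>.\<close>
  define d where "d = f 0 ^ card (u - {j})"
  have "d \<noteq> 0" using \<open>f 0 \<noteq> 0\<close> by (simp add: d_def)
  have split: "(\<Prod>i\<in>v. g (E t $ i) (E t' $ i)) = g t t' * g 0 0 ^ card (v - {j})"
    if "j \<in> v" for g :: "real \<Rightarrow> real \<Rightarrow> real" and t t' and v :: "'s set"
  proof -
    have "(\<Prod>i\<in>v - {j}. g (E t $ i) (E t' $ i)) = (\<Prod>i\<in>v - {j}. g 0 0)"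
      by (rule prod.cong) (auto simp: E_def)
    then show ?thesis using prod.remove[of v j "\<lambda>i. g (E t $ i) (E t' $ i)"] that
      by (simp add: E_def)
  qed
  have nosplit: "(\<Prod>i\<in>v. g (E t $ i) (E t' $ i)) = g 0 0 ^ card v"
    if "j \<notin> v" for g :: "real \<Rightarrow> real \<Rightarrow> real" and t t' and v :: "'s set"
  proof -
    have "(\<Prod>i\<in>v. g (E t $ i) (E t' $ i)) = (\<Prod>i\<in>v. g 0 0)"
      by (rule prod.cong) (use that in \<open>auto simp: E_def\<close>)
    then show ?thesis by simp
  qed
  \<comment> \<open>Along the axis the weighted kernel is A + B times the univariate one: sets
    avoiding j contribute to A, sets containing j to B.\<close>
  define A where "A = 1 + (\<Sum>v\<in>{v. v \<noteq> {} \<and> j \<notin> v}. \<gamma> v * ?\<kappa> 0 0 ^ card v)"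
  define B where "B = (\<Sum>v\<in>{v. j \<in> v}. \<gamma> v * ?\<kappa> 0 0 ^ card (v - {j}))"
  have "?\<kappa> 0 0 \<ge> 0"
    using psd_kernel.form_nonneg[OF psd, of "[(1, 0)]"] by (simp add: form_def)
  then have B: "B \<ge> 0" unfolding B_def by (intro sum_nonneg mult_nonneg_nonneg \<gamma>) auto
  have KE: "?K (E t) (E t') = A + B * ?\<kappa> t t'" for t t'
  proof -
    have "{v. v \<noteq> {}} = {v. v \<noteq> {} \<and> j \<notin> v} \<union> {v. j \<in> v}" by auto
    then have "?K (E t) (E t') = 1
        + ((\<Sum>v\<in>{v. v \<noteq> {} \<and> j \<notin> v}. \<gamma> v * (\<Prod>i\<in>v. ?\<kappa> (E t $ i) (E t' $ i)))
        + (\<Sum>v\<in>{v. j \<in> v}. \<gamma> v * (\<Prod>i\<in>v. ?\<kappa> (E t $ i) (E t' $ i))))"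
      unfolding weighted_kernel_def by (simp only:) (subst sum.union_disjoint, auto)
    also have "(\<Sum>v\<in>{v. j \<in> v}. \<gamma> v * (\<Prod>i\<in>v. ?\<kappa> (E t $ i) (E t' $ i))) = B * ?\<kappa> t t'"
      unfolding B_def sum_distrib_right
      by (intro sum.cong refl) (simp only: mem_Collect_eq split[where g = ?\<kappa>] mult_ac)
    also have "(\<Sum>v\<in>{v. v \<noteq> {} \<and> j \<notin> v}. \<gamma> v * (\<Prod>i\<in>v. ?\<kappa> (E t $ i) (E t' $ i))) = A - 1"
      unfolding A_def add_diff_cancel_left'
      by (rule sum.cong, simp, subst nosplit[where g = ?\<kappa>], simp_all)
    finally show ?thesis by simp
  qed
  \<comment> \<open>With this e, membership would make d^2 times the square of
    \<open>lin xs f\<close> smaller than itself. The summand 1 excludes a zero denominator.\<close>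
  define e where "e = d\<^sup>2 / (C * B + 1)"
  have CB: "C * B + 1 > 0" using C(1) B by (simp add: add_nonneg_pos)
  then have "e > 0" using \<open>d \<noteq> 0\<close> by (simp add: e_def)
  then obtain xs where xs: "xs \<in> combos {0..1}" "lin xs (\<lambda>_. 1) = 0"
    and lt: "form ?\<kappa> xs xs < e * (lin xs f)\<^sup>2" using small by blast
  have "form ?\<kappa> xs xs \<ge> 0" by (rule psd_kernel.form_nonneg[OF psd xs(1)])
  let ?ys = "map (\<lambda>(c, t). (c * 1, E t)) xs"
  have lin_ys: "lin ?ys g = lin xs (\<lambda>t. g (E t))" for g
    using lin_map[of "\<lambda>_. 1" E xs g] by simp
  have ys: "?ys \<in> combos unit_cube"
    using xs(1) by (rule combos_map) (auto simp: E_def unit_cube_def)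
  have "form ?K ?ys ?ys = form (\<lambda>t t'. A * 1 + B * ?\<kappa> t t') xs xs"
    unfolding form_def lin_ys KE by simp
  also have "\<dots> = form (\<lambda>_ _. A * 1) xs xs + form (\<lambda>t t'. B * ?\<kappa> t t') xs xs"
    by (rule form_add)
  also have "\<dots> = A * (lin xs (\<lambda>_. 1))\<^sup>2 + B * form ?\<kappa> xs xs"
    using form_rank_one[of "\<lambda>_. 1" xs] by (simp only: form_cmult mult_1)
  finally have form_ys: "form ?K ?ys ?ys = B * form ?\<kappa> xs xs" using xs(2) by simp
  have "lin ?ys (\<lambda>x\<in>unit_cube. ?h x) = lin ?ys ?h" by (rule lin_restrict[OF ys])
  also have "\<dots> = lin xs (\<lambda>t. f t * d)"
    unfolding lin_ys d_def using split[OF j, of "\<lambda>a b. f a"] by simp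
  finally have "(lin xs f)\<^sup>2 * d\<^sup>2 \<le> C * (B * form ?\<kappa> xs xs)"
    using C(2)[OF ys] unfolding form_ys by (simp add: lin_cmult_right power_mult_distrib)
  also have "\<dots> \<le> (C * B + 1) * form ?\<kappa> xs xs"
    using \<open>form ?\<kappa> xs xs \<ge> 0\<close> by (simp add: algebra_simps)
  also have "\<dots> < (C * B + 1) * (e * (lin xs f)\<^sup>2)"
    using lt CB by (rule mult_strict_left_mono)
  also have "\<dots> = (lin xs f)\<^sup>2 * d\<^sup>2" using CB by (simp add: e_def)
  finally show False by simp
qed

section \<open>Bernoulli polynomials and the Euler--Maclaurin formula\<close>

text \<open>Dividing by n! makes differentiation lower the index by one.\<close>

definition \<beta> :: "nat \<Rightarrow> real \<Rightarrow> real" where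
  "\<beta> n x = bernoulli_poly n x / fact n"

lemma bernoulli_poly_derivative:
  "(bernoulli_poly (Suc n) has_real_derivative real (Suc n) * bernoulli_poly n x) (at x)"
proof -
  \<comment> \<open>The constant summand, of index \<open>Suc n\<close>, is split off so that all
    remaining powers of x have a positive exponent.\<close>
  have "((\<lambda>x. (\<Sum>k\<le>n. real (Suc n choose k) * bernoulli_number k * x ^ (Suc n - k))
      + bernoulli_number (Suc n)) has_real_derivative
      (\<Sum>k\<le>n. real (Suc n choose k) * bernoulli_number k * (real (Suc n - k) * x ^ (n - k)))) (at x)"
  proof -
    have "((\<lambda>x. (\<Sum>k\<le>n. real (Suc n choose k) * bernoulli_number k * x ^ (Suc n - k)))
        has_real_derivative
        (\<Sum>k\<le>n. real (Suc n choose k) * bernoulli_number k * (real (Suc n - k) * x ^ (n - k)))) (at x)"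
    proof (rule DERIV_sum)
      fix k assume "k \<in> {..n}"
      then show "((\<lambda>x. real (Suc n choose k) * bernoulli_number k * x ^ (Suc n - k))
          has_real_derivative
          real (Suc n choose k) * bernoulli_number k * (real (Suc n - k) * x ^ (n - k))) (at x)"
        using DERIV_cmult[OF DERIV_pow[of "Suc n - k" x UNIV],
            of "real (Suc n choose k) * bernoulli_number k"]
        by (simp add: Suc_diff_le del: binomial_Suc_Suc bernoulli_number.simps of_nat_Suc)
    qed
    from DERIV_add[OF this DERIV_const[of "bernoulli_number (Suc n)"]] show ?thesis by simp
  qed
  moreover have "(\<lambda>x. (\<Sum>k\<le>n. real (Suc n choose k) * bernoulli_number k * x ^ (Suc n - k))
      + bernoulli_number (Suc n)) = bernoulli_poly (Suc n)"
    by (intro ext) (simp add: bernoulli_poly_def del: bernoulli_number.simps binomial_Suc_Suc)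
  moreover have "(\<Sum>k\<le>n. real (Suc n choose k) * bernoulli_number k * (real (Suc n - k) * x ^ (n - k)))
      = real (Suc n) * bernoulli_poly n x"
    unfolding bernoulli_poly_def sum_distrib_left
  proof (rule sum.cong)
    fix k assume "k \<in> {..n}"
    have "real (Suc n choose k) * real (Suc n - k) = real (Suc n) * real (n choose k)"
      using binomial_absorb_comp[of "Suc n" k]
      by (simp only: of_nat_mult[symmetric] diff_Suc_1 mult.commute[of "Suc n choose k"])
    then show "real (Suc n choose k) * bernoulli_number k * (real (Suc n - k) * x ^ (n - k))
        = real (Suc n) * (real (n choose k) * bernoulli_number k * x ^ (n - k))"
      by (metis (no_types, opaque_lifting) mult.assoc mult.commute)
  qed simp
  ultimately show ?thesis by simp
qed

lemma \<beta>_derivative: "(\<beta> (Suc n) has_real_derivative \<beta> n x) (at x)"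
  using DERIV_cdivide[OF bernoulli_poly_derivative[of n x], of "fact (Suc n)"]
  by (simp add: \<beta>_def[abs_def] field_simps del: of_nat_Suc)

lemma \<beta>_0 [simp]: "\<beta> 0 x = 1"
  by (simp add: \<beta>_def bernoulli_poly_def)

lemma \<beta>_1 [simp]: "\<beta> (Suc 0) x = x - 1 / 2"
  by (simp add: \<beta>_def bernoulli_poly_def)

lemma continuous_on_\<beta> [continuous_intros]: "continuous_on S (\<beta> n)"
  unfolding \<beta>_def[abs_def] bernoulli_poly_def by (intro continuous_intros) simp

text \<open>The recursion of \<open>bernoulli_number\<close> says that the summands of B_n(1) other
  than the last cancel, and the last one is B_n(0).\<close>

lemma \<beta>_periodic:
  assumes "2 \<le> n"
  shows "\<beta> n 1 = \<beta> n 0"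
proof -
  obtain m where m: "n = Suc (Suc m)" using assms by (metis add_2_eq_Suc less_eqE)
  have "real (Suc (Suc m)) * bernoulli_number (Suc m)
      = - (\<Sum>k\<le>m. real (Suc (Suc m) choose k) * bernoulli_number k)"
    by (simp del: of_nat_Suc binomial_Suc_Suc)
  then have "(\<Sum>k\<le>Suc m. real (Suc (Suc m) choose k) * bernoulli_number k) = 0"
    by (simp del: bernoulli_number.simps of_nat_Suc add: binomial_Suc_n)
  then have "bernoulli_poly n 1 = bernoulli_number n"
    by (simp add: bernoulli_poly_def m del: bernoulli_number.simps binomial_Suc_Suc)
  moreover have "bernoulli_poly n 0 = (\<Sum>k\<le>n. if k = n then bernoulli_number n else 0)"
    unfolding bernoulli_poly_def by (rule sum.cong) auto
  ultimately show ?thesis by (simp add: \<beta>_def)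
qed

text \<open>The defect D of index n + 1 has derivative 0, so it is a constant c, and the next defect
  has slope -c. Periodicity gives the latter equal values at 0 and 1, which forces c = 0.\<close>

lemma \<beta>_reflect: "\<beta> n (1 - x) = (- 1) ^ n * \<beta> n x"
proof (induction n arbitrary: x)
  case (Suc n)
  define D where "D m x = \<beta> m (1 - x) - (- 1) ^ m * \<beta> m x" for m x
  have D': "(D (Suc m) has_real_derivative - D m x) (at x)" for m x
    unfolding D_def
    by (auto intro!: derivative_eq_intros DERIV_chain2[OF \<beta>_derivative] simp: \<beta>_derivative)
  have "(D (Suc n) has_real_derivative 0) (at x)" for x
    using D'[of n x] Suc.IH by (simp add: D_def)
  then have const: "D (Suc n) x = D (Suc n) 0" for x
    by (intro DERIV_isconst_all[of "D (Suc n)"]) auto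
  have "((\<lambda>x. D (Suc (Suc n)) x + D (Suc n) 0 * x) has_real_derivative 0) (at x)" for x
    using D'[of "Suc n" x] const[of x] by (auto intro!: derivative_eq_intros)
  then have "D (Suc (Suc n)) 1 + D (Suc n) 0 * 1 = D (Suc (Suc n)) 0 + D (Suc n) 0 * 0"
    by (intro DERIV_isconst_all[of "\<lambda>x. D (Suc (Suc n)) x + D (Suc n) 0 * x"]) auto
  moreover have "D (Suc (Suc n)) 1 = D (Suc (Suc n)) 0"
    using \<beta>_periodic[of "Suc (Suc n)"] by (simp add: D_def)
  ultimately have "D (Suc n) x = 0" using const[of x] by simp
  then show ?case by (simp add: D_def)
qed simp

text \<open>The periodic continuation of \<open>\<beta> n\<close> from \<open>[0,1)\<close>, on \<open>[-1,1)\<close>.\<close>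

definition \<beta>per :: "nat \<Rightarrow> real \<Rightarrow> real" where
  "\<beta>per n u = (if 0 \<le> u then \<beta> n u else \<beta> n (u + 1))"

lemma continuous_on_\<beta>per:
  assumes "2 \<le> n"
  shows "continuous_on S (\<beta>per n)"
proof -
  have "continuous_on UNIV (\<lambda>u. if u \<le> 0 then \<beta> n (u + 1) else \<beta> n u)"
    by (rule continuous_on_cases_le)
      (auto intro!: continuous_intros continuous_on_compose2[OF continuous_on_\<beta>[of UNIV]]
        simp: \<beta>_periodic[OF assms])
  also have "(\<lambda>u. if u \<le> 0 then \<beta> n (u + 1) else \<beta> n u) = \<beta>per n"
    by (auto simp: \<beta>per_def \<beta>_periodic[OF assms])
  finally show ?thesis by (rule continuous_on_subset) simp
qed

lemma continuous_on_\<beta>per_diff: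
  "2 \<le> n \<Longrightarrow> continuous_on S (\<lambda>t. \<beta>per n (y - t))"
  by (intro continuous_on_compose2[OF continuous_on_\<beta>per[of n UNIV]] continuous_intros) auto

lemma \<beta>per_derivative:
  assumes "u \<noteq> 0"
  shows "(\<beta>per (Suc n) has_real_derivative \<beta>per n u) (at u)"
proof (cases "u > 0")
  case True
  have "(\<beta> (Suc n) has_real_derivative \<beta>per n u) (at u)"
    using \<beta>_derivative[of n u] True by (simp add: \<beta>per_def)
  then show ?thesis
    by (rule has_field_derivative_transform_within_open[where S = "{0<..}"])
      (use True in \<open>auto simp: \<beta>per_def\<close>)
next
  case False
  have "((\<lambda>u. \<beta> (Suc n) (u + 1)) has_real_derivative \<beta>per n u) (at u)"
    using DERIV_chain2[where g = "\<lambda>u. u + 1", OF \<beta>_derivative[of n "u + 1"]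
        DERIV_add[OF DERIV_ident DERIV_const]] False assms
    by (simp add: \<beta>per_def)
  then show ?thesis
    by (rule has_field_derivative_transform_within_open[where S = "{..<0}"])
      (use False assms in \<open>auto simp: \<beta>per_def\<close>)
qed

lemma \<beta>per_diff_derivative:
  assumes "t \<noteq> y"
  shows "((\<lambda>t. \<beta>per (Suc n) (y - t)) has_real_derivative - \<beta>per n (y - t)) (at t)"
  using DERIV_chain2[where g = "\<lambda>t. y - t", OF \<beta>per_derivative[of "y - t" n]
      DERIV_diff[OF DERIV_const DERIV_ident]] assms
  by simp

lemma \<beta>per_0: "0 \<le> y \<Longrightarrow> \<beta>per n y = \<beta> n y"
  by (simp add: \<beta>per_def)

lemma \<beta>per_1: "\<lbrakk>2 \<le> n; y \<le> 1\<rbrakk> \<Longrightarrow> \<beta>per n (y - 1) = \<beta> n y"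
  using \<beta>_periodic[of n] by (auto simp: \<beta>per_def)

text \<open>Reflection turns the term B_2a(|x - y|) of the Sobolev kernel into the periodic
  function, whose derivatives lower the index on both sides of the diagonal.\<close>

lemma \<beta>per_abs:
  assumes "even n"
  shows "\<beta>per n u = \<beta> n \<bar>u\<bar>"
  using \<beta>_reflect[of n "- u"] assms by (auto simp: \<beta>per_def add.commute)

section \<open>The Euler-Maclaurin formula\<close>

text \<open>\<open>F i\<close> plays the role of the i-th derivative of \<open>F 0\<close>. The
  finite exceptional set spares a check of derivatives of kernel sections at the diagonal point;
  with continuity the fundamental theorem of calculus still applies.\<close>

definition jet :: "nat \<Rightarrow> (nat \<Rightarrow> real \<Rightarrow> real) \<Rightarrow> bool" where
  "jet a F \<longleftrightarrow> (\<forall>i\<le>a. continuous_on {0..1} (F i)) \<and>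
    (\<exists>S. finite S \<and> (\<forall>i<a. \<forall>t\<in>{0<..<1} - S. (F i has_real_derivative F (Suc i) t) (at t)))"

lemma jet_mono: "\<lbrakk>jet a F; b \<le> a\<rbrakk> \<Longrightarrow> jet b F"
  unfolding jet_def by (meson le_trans less_le_trans)

lemma jet_continuous: "\<lbrakk>jet a F; i \<le> a\<rbrakk> \<Longrightarrow> continuous_on {0..1} (F i)"
  by (simp add: jet_def)

lemma integral_of_derivative:
  fixes G g :: "real \<Rightarrow> real"
  assumes "finite S" "continuous_on {0..1} G"
    and "\<And>t. t \<in> {0<..<1} - S \<Longrightarrow> (G has_real_derivative g t) (at t)"
  shows "integral {0..1} g = G 1 - G 0"
  by (intro integral_unique fundamental_theorem_of_calculus_interior_strong[OF assms(1)])
    (use assms in \<open>auto simp flip: has_real_derivative_iff_has_vector_derivative\<close>)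

lemma jet_integral:
  assumes "jet a F" "i < a"
  shows "integral {0..1} (F (Suc i)) = F i 1 - F i 0"
proof -
  obtain S where "finite S" "\<And>t. t \<in> {0<..<1} - S \<Longrightarrow> (F i has_real_derivative F (Suc i) t) (at t)"
    using assms unfolding jet_def by blast
  then show ?thesis using assms by (intro integral_of_derivative jet_continuous) auto
qed

text \<open>The induction integrates the remainder by parts: its second factor vanishes at t = 0 and
  t = 1 and has as t-derivative the periodic function of one index less. The boundary term of order
  n + 1 equals the integral of \<open>F (n + 2)\<close> times \<open>\<beta> (n + 2) y\<close> and
  sits inside the remainder, so the sum stops at n.\<close>

theorem Euler_Maclaurin:
  assumes "jet (n + 2) F" and y: "y \<in> {0..1}"
  shows "F 0 y = integral {0..1} (F 0) + (\<Sum>i\<le>n. (F i 1 - F i 0) * \<beta> (Suc i) y)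
    + integral {0..1} (\<lambda>t. F (n + 2) t * (\<beta> (n + 2) y - \<beta>per (n + 2) (y - t)))"
  using assms(1)
proof (induction n)
  case 0
  then obtain S where S: "finite S" "\<And>i t. i < 2 \<Longrightarrow> t \<in> {0<..<1} - S \<Longrightarrow>
      (F i has_real_derivative F (Suc i) t) (at t)" unfolding jet_def by auto
  have cont: "continuous_on {0..1} (F i)" if "i \<le> 2" for i
    using 0 that by (simp add: jet_def)
  define r where "r t = \<beta> 2 y - \<beta>per 2 (y - t)" for t
  have r: "continuous_on {0..1} r"
    unfolding r_def by (intro continuous_intros continuous_on_\<beta>per_diff) auto
  have r': "(r has_real_derivative \<beta>per (Suc 0) (y - t)) (at t)" if "t \<noteq> y" for t
    using \<beta>per_diff_derivative[OF that, of "Suc 0"]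
    unfolding r_def by (auto intro!: derivative_eq_intros simp: numeral_2_eq_2)
  \<comment> \<open>\<open>\<beta>per 1 (y - t)\<close> jumps by \<open>1\<close> at \<open>t = y\<close>; the case distinction in \<open>q\<close> cancels the jump.\<close>
  define q where "q t = F 0 t * \<beta>per (Suc 0) (y - t) - (if y < t then F 0 y else 0)" for t
  have q_eq: "q t = F 0 t * (y - t)
      + (if t \<le> y then - (F 0 t / 2) else F 0 t / 2 - F 0 y)" for t
    by (auto simp: q_def \<beta>per_def algebra_simps)
  have q: "continuous_on {0..1} q"
  proof -
    have "continuous_on {0..1} (\<lambda>t. if t \<le> y then - (F 0 t / 2) else F 0 t / 2 - F 0 y)"
      by (rule continuous_on_cases_le)
        (auto intro!: continuous_intros continuous_on_subset[OF cont[of 0]])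
    then show ?thesis
      unfolding q_eq[abs_def] by (intro continuous_intros cont) auto
  qed
  have q': "(q has_real_derivative F 1 t * \<beta>per (Suc 0) (y - t) - F 0 t) (at t)"
    if t: "t \<in> {0<..<1} - S" "t \<noteq> y" for t
  proof -
    have 1: "((\<lambda>t. F 0 t * \<beta>per (Suc 0) (y - t)) has_real_derivative
        F 1 t * \<beta>per (Suc 0) (y - t) - F 0 t) (at t)"
      using S(2)[of 0 t] t \<beta>per_diff_derivative[OF t(2), of 0]
      by (auto intro!: derivative_eq_intros simp: \<beta>per_def)
    have 2: "((\<lambda>t. if y < t then F 0 y else 0) has_real_derivative 0) (at t)"
    proof (cases "y < t")
      case True
      show ?thesis
        by (rule has_field_derivative_transform_within_open[OF DERIV_const[of "F 0 y"],
              where S = "{y<..}"]) (use True in auto)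
    next
      case False
      show ?thesis
        by (rule has_field_derivative_transform_within_open[OF DERIV_const[of 0],
              where S = "{..<y}"]) (use False t(2) in auto)
    qed
    show ?thesis using DERIV_diff[OF 1 2] by (simp add: q_def[abs_def])
  qed
  \<comment> \<open>The primitive \<open>F 1 t * r t - q t\<close> performs two integrations by
    parts at once: the products of \<open>F 1 t\<close> with the periodic function cancel.\<close>
  have "integral {0..1} (\<lambda>t. F 2 t * r t + F 0 t) = (F 1 1 * r 1 - q 1) - (F 1 0 * r 0 - q 0)"
  proof (rule integral_of_derivative[of "insert y S"])
    fix t assume t: "t \<in> {0<..<1} - insert y S"
    then show "((\<lambda>t. F 1 t * r t - q t) has_real_derivative F 2 t * r t + F 0 t) (at t)"
      using S(2)[of 1 t] r'[of t] q'[of t]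
      by (auto intro!: derivative_eq_intros simp: numeral_2_eq_2)
  qed (use S(1) in \<open>auto intro!: continuous_intros cont q r\<close>)
  moreover have "r 0 = 0" "r 1 = 0" using y by (auto simp: r_def \<beta>per_0 \<beta>per_1)
  \<comment> \<open>For y = 1 no t exceeds y and the correction in \<open>q\<close> is absent; the
    value -1/2 of the periodic function at 0 then gives the same result.\<close>
  moreover have "q 0 - q 1 = F 0 y - (F 0 1 - F 0 0) * \<beta> (Suc 0) y"
    using y by (cases "y = 1") (auto simp: q_def \<beta>per_def field_simps)
  moreover have "integral {0..1} (\<lambda>t. F 2 t * r t + F 0 t)
      = integral {0..1} (\<lambda>t. F 2 t * r t) + integral {0..1} (F 0)"
    by (intro integral_add integrable_continuous_real continuous_intros cont r) auto
  ultimately have "F 0 y = integral {0..1} (F 0) + (F 0 1 - F 0 0) * \<beta> (Suc 0) y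
      + integral {0..1} (\<lambda>t. F 2 t * r t)" by simp
  then show ?case by (simp add: r_def numeral_2_eq_2)
next
  case (Suc n)
  have IH: "F 0 y = integral {0..1} (F 0) + (\<Sum>i\<le>n. (F i 1 - F i 0) * \<beta> (Suc i) y)
    + integral {0..1} (\<lambda>t. F (n + 2) t * (\<beta> (n + 2) y - \<beta>per (n + 2) (y - t)))"
    by (rule Suc.IH[OF jet_mono[OF Suc.prems]]) simp
  obtain S where S: "finite S" "\<And>i t. i < n + 3 \<Longrightarrow> t \<in> {0<..<1} - S \<Longrightarrow>
      (F i has_real_derivative F (Suc i) t) (at t)"
    using Suc.prems unfolding jet_def by (auto simp: numeral_3_eq_3)
  have cont: "continuous_on {0..1} (F i)" if "i \<le> n + 3" for i
    using Suc.prems that by (simp add: jet_def)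
  define r where "r m t = \<beta> m y - \<beta>per m (y - t)" for m t
  have r: "continuous_on {0..1} (r m)" if "m \<ge> 2" for m
    unfolding r_def by (intro continuous_intros continuous_on_\<beta>per_diff that)
  have p: "continuous_on {0..1} (\<lambda>t. \<beta>per (n + 2) (y - t))"
    by (intro continuous_on_\<beta>per_diff) simp
  have "integral {0..1} (\<lambda>t. F (n + 3) t * r (n + 3) t + F (n + 2) t * \<beta>per (n + 2) (y - t))
      = F (n + 2) 1 * r (n + 3) 1 - F (n + 2) 0 * r (n + 3) 0"
  proof (rule integral_of_derivative[of "insert y S"])
    fix t assume t: "t \<in> {0<..<1} - insert y S"
    have "(r (n + 3) has_real_derivative \<beta>per (n + 2) (y - t)) (at t)"
      using \<beta>per_diff_derivative[of t y "n + 2"] t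
      unfolding r_def by (auto intro!: derivative_eq_intros simp: numeral_3_eq_3)
    then show "((\<lambda>t. F (n + 2) t * r (n + 3) t) has_real_derivative
        F (n + 3) t * r (n + 3) t + F (n + 2) t * \<beta>per (n + 2) (y - t)) (at t)"
      using S(2)[of "n + 2" t] t
      by (auto intro!: derivative_eq_intros simp: numeral_3_eq_3)
  qed (use S(1) in \<open>auto intro!: continuous_intros cont r\<close>)
  also have "\<dots> = 0" using y by (auto simp: r_def \<beta>per_0 \<beta>per_1)
  also have "integral {0..1} (\<lambda>t. F (n + 3) t * r (n + 3) t + F (n + 2) t * \<beta>per (n + 2) (y - t))
      = integral {0..1} (\<lambda>t. F (n + 3) t * r (n + 3) t)
        + integral {0..1} (\<lambda>t. F (n + 2) t * \<beta>per (n + 2) (y - t))"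
    by (intro integral_add integrable_continuous_real continuous_intros cont r p) auto
  finally have 1: "integral {0..1} (\<lambda>t. F (n + 3) t * r (n + 3) t)
        = - integral {0..1} (\<lambda>t. F (n + 2) t * \<beta>per (n + 2) (y - t))" by simp
  have "integral {0..1} (\<lambda>t. F (n + 2) t * r (n + 2) t)
      = integral {0..1} (\<lambda>t. F (n + 2) t * \<beta> (n + 2) y - F (n + 2) t * \<beta>per (n + 2) (y - t))"
    by (simp add: r_def algebra_simps)
  also have "\<dots> = integral {0..1} (\<lambda>t. F (n + 2) t * \<beta> (n + 2) y)
      - integral {0..1} (\<lambda>t. F (n + 2) t * \<beta>per (n + 2) (y - t))"
    by (intro integral_diff integrable_continuous_real continuous_intros cont p) auto
  also have "integral {0..1} (\<lambda>t. F (n + 2) t * \<beta> (n + 2) y)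
      = (F (n + 1) 1 - F (n + 1) 0) * \<beta> (n + 2) y"
    using jet_integral[OF Suc.prems, of "n + 1"] by simp
  finally show ?case using IH 1 by (simp add: r_def numeral_3_eq_3)
qed

section \<open>The univariate kernels\<close>

lemma continuous_on_lin:
  assumes "xs \<in> combos D" "\<And>y. y \<in> D \<Longrightarrow> continuous_on S (g y)"
  shows "continuous_on S (\<lambda>t. lin xs (\<lambda>y. g y t))"
  using assms(1)
proof (induction xs)
  case (Cons p xs)
  then show ?case
    by (cases p) (auto intro!: continuous_intros assms(2))
qed simp

text \<open>Integrability is carried along because additivity of the integral requires it in the
  induction.\<close>

lemma lin_integral:
  assumes "xs \<in> combos D" "\<And>y. y \<in> D \<Longrightarrow> g y integrable_on S"
  shows "integral S (\<lambda>t. lin xs (\<lambda>y. g y t)) = lin xs (\<lambda>y. integral S (g y))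
    \<and> (\<lambda>t. lin xs (\<lambda>y. g y t)) integrable_on S"
  using assms(1)
proof (induction xs)
  case (Cons p xs)
  obtain c y where p: "p = (c, y)" by force
  with Cons have y: "y \<in> D"
    and IH: "integral S (\<lambda>t. lin xs (\<lambda>y. g y t)) = lin xs (\<lambda>y. integral S (g y))"
    "(\<lambda>t. lin xs (\<lambda>y. g y t)) integrable_on S" by auto
  have "(\<lambda>t. c * g y t) integrable_on S"
    using assms(2)[OF y] by (rule integrable_on_mult_right)
  then show ?case using IH by (simp add: p integral_add integrable_add)
qed (simp add: integrable_0)

definition remainder :: "nat \<Rightarrow> real \<Rightarrow> real \<Rightarrow> real" where
  "remainder a y t = \<beta> a y - \<beta>per a (y - t)"

lemma continuous_on_remainder: "2 \<le> a \<Longrightarrow> continuous_on S (remainder a y)"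
  unfolding remainder_def[abs_def] by (intro continuous_intros continuous_on_\<beta>per_diff)

lemma lin_Euler_Maclaurin:
  assumes F: "jet (n + 2) F" and mean: "integral {0..1} (F 0) = 0" and xs: "xs \<in> combos {0..1}"
  shows "lin xs (F 0) = (\<Sum>i\<le>n. (F i 1 - F i 0) * lin xs (\<beta> (Suc i)))
    + integral {0..1} (\<lambda>t. F (n + 2) t * lin xs (\<lambda>y. remainder (n + 2) y t))"
proof -
  have "lin xs (F 0) = lin xs (\<lambda>y. (\<Sum>i\<le>n. (F i 1 - F i 0) * \<beta> (Suc i) y)
      + integral {0..1} (\<lambda>t. F (n + 2) t * remainder (n + 2) y t))"
    by (rule lin_cong[OF xs]) (use Euler_Maclaurin[OF F] mean in \<open>simp add: remainder_def\<close>)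
  also have "\<dots> = (\<Sum>i\<le>n. (F i 1 - F i 0) * lin xs (\<beta> (Suc i)))
      + lin xs (\<lambda>y. integral {0..1} (\<lambda>t. F (n + 2) t * remainder (n + 2) y t))"
    by (simp add: lin_add lin_sum lin_cmult)
  also have "lin xs (\<lambda>y. integral {0..1} (\<lambda>t. F (n + 2) t * remainder (n + 2) y t))
      = integral {0..1} (\<lambda>t. lin xs (\<lambda>y. F (n + 2) t * remainder (n + 2) y t))"
    by (intro lin_integral[OF xs, THEN conjunct1, symmetric] integrable_continuous_real
        continuous_intros continuous_on_remainder jet_continuous[OF F]) auto
  finally show ?thesis by (simp add: lin_cmult)
qed

section \<open>Feature expansion of the Sobolev kernel\<close>

text \<open>The i-th derivative in t of the mean-zero kernel section at x. Each differentiation of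
  the periodic term contributes a sign; for i \<le> a its index 2a - i is at least a, hence the term
  is continuous when a \<ge> 2.\<close>

definition sob_jet :: "nat \<Rightarrow> real \<Rightarrow> nat \<Rightarrow> real \<Rightarrow> real" where
  "sob_jet a x i t = (\<Sum>\<tau>=1..a. (if i \<le> \<tau> then \<beta> (\<tau> - i) t else 0) * \<beta> \<tau> x)
     + (- 1) ^ (a + 1 + i) * \<beta>per (2 * a - i) (x - t)"

lemma sob_jet_0: "sob_jet a x 0 y = mean_zero_part (sob_kernel1 a) x y"
  using \<beta>per_abs[of "2 * a" "x - y"]
  by (simp add: sob_jet_def sob_kernel1_def \<beta>_def power2_eq_square mult.commute)

lemma sob_jet_derivative:
  assumes "i < a" "t \<noteq> x"
  shows "(sob_jet a x i has_real_derivative sob_jet a x (Suc i) t) (at t)"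
proof -
  have 1: "((\<lambda>t. if i \<le> \<tau> then \<beta> (\<tau> - i) t else 0) has_real_derivative
      (if Suc i \<le> \<tau> then \<beta> (\<tau> - Suc i) t else 0)) (at t)" for \<tau>
  proof (cases "i < \<tau>")
    case True
    then have "\<tau> - i = Suc (\<tau> - Suc i)" by simp
    then show ?thesis using \<beta>_derivative[of "\<tau> - Suc i" t] True by simp
  next
    case False
    then show ?thesis by (cases "i = \<tau>") (auto simp: \<beta>_0[abs_def])
  qed
  have "2 * a - i = Suc (2 * a - Suc i)" using assms by simp
  then have "((\<lambda>t. \<beta>per (2 * a - i) (x - t)) has_real_derivative - \<beta>per (2 * a - Suc i) (x - t)) (at t)"
    using \<beta>per_diff_derivative[OF assms(2), of "2 * a - Suc i"] by simp
  then show ?thesis unfolding sob_jet_def[abs_def]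
    by (intro DERIV_cong[OF DERIV_add[OF DERIV_sum[OF DERIV_cmult_right[OF 1]] DERIV_cmult]]) auto
qed

lemma jet_sob_jet:
  assumes "2 \<le> a"
  shows "jet a (sob_jet a x)"
proof -
  have "continuous_on {0..1} (sob_jet a x i)" if "i \<le> a" for i
  proof -
    have "continuous_on {0..1} (\<lambda>t. if i \<le> \<tau> then \<beta> (\<tau> - i) t else 0)" for \<tau>
      by (cases "i \<le> \<tau>") (auto intro: continuous_intros)
    then show ?thesis
      unfolding sob_jet_def using that assms by (intro continuous_intros continuous_on_\<beta>per_diff) auto
  qed
  moreover have "\<exists>S. finite S \<and> (\<forall>i<a. \<forall>t\<in>{0<..<1} - S.
      (sob_jet a x i has_real_derivative sob_jet a x (Suc i) t) (at t))"
    by (rule exI[of _ "{x}"]) (auto intro: sob_jet_derivative)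
  ultimately show ?thesis by (simp add: jet_def)
qed

text \<open>The periodic term and every \<open>\<beta> k\<close> with k \<noteq> 1 agree at 0 and 1,
  while \<open>\<beta> 1\<close> increases by 1. So only \<tau> = i + 1 survives.\<close>

lemma sob_jet_boundary:
  assumes "Suc i < a" "x \<in> {0..1}"
  shows "sob_jet a x i 1 - sob_jet a x i 0 = \<beta> (Suc i) x"
proof -
  have "sob_jet a x i 1 - sob_jet a x i 0
      = (\<Sum>\<tau>=1..a. ((if i \<le> \<tau> then \<beta> (\<tau> - i) 1 else 0) - (if i \<le> \<tau> then \<beta> (\<tau> - i) 0 else 0)) * \<beta> \<tau> x)"
    using assms by (simp add: sob_jet_def \<beta>per_0 \<beta>per_1 sum_subtractf left_diff_distrib)
  also have "\<dots> = (\<Sum>\<tau>=1..a. if \<tau> = Suc i then \<beta> (Suc i) x else 0)"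
  proof (rule sum.cong)
    fix \<tau>
    consider "\<tau> < i" | "\<tau> = i" | "\<tau> = Suc i" | "2 \<le> \<tau> - i" by linarith
    then show "((if i \<le> \<tau> then \<beta> (\<tau> - i) 1 else 0) - (if i \<le> \<tau> then \<beta> (\<tau> - i) 0 else 0)) * \<beta> \<tau> x
        = (if \<tau> = Suc i then \<beta> (Suc i) x else 0)"
    proof cases
      case 4
      then show ?thesis using \<beta>_periodic[of "\<tau> - i"] by auto
    qed (auto simp: Suc_diff_le)
  qed simp
  finally show ?thesis using assms by simp
qed

text \<open>At order a only \<tau> = a is left of the sum, and the sign is (-1)^(2a+1). The top
  derivative of a kernel section is thus the remainder feature itself.\<close>

lemma sob_jet_top: "sob_jet a x a t = remainder a x t" if "1 \<le> a"
proof -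
  have "(\<Sum>\<tau>=1..a. (if a \<le> \<tau> then \<beta> (\<tau> - a) t else 0) * \<beta> \<tau> x)
      = (\<Sum>\<tau>=1..a. if \<tau> = a then \<beta> a x else 0)"
    by (rule sum.cong) auto
  then show ?thesis using that by (simp add: sob_jet_def remainder_def flip: mult_2)
qed

lemma integral_\<beta>: "integral {0..1} (\<beta> (Suc n)) = 0"
  using integral_of_derivative[of "{}" "\<beta> (Suc (Suc n))" "\<beta> (Suc n)"] \<beta>_derivative
    \<beta>_periodic[of "Suc (Suc n)"] by (simp add: continuous_on_\<beta>)

lemma integral_sob_jet:
  assumes "1 \<le> a" "x \<in> {0..1}"
  shows "integral {0..1} (sob_jet a x 0) = 0"
proof -
  have "((\<lambda>t. - \<beta>per (Suc (2 * a)) (x - t)) has_real_derivative \<beta>per (2 * a) (x - t)) (at t)"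
    if "t \<noteq> x" for t
    using DERIV_minus[OF \<beta>per_diff_derivative[OF that, of "2 * a"]] by simp
  then have 1: "integral {0..1} (\<lambda>t. \<beta>per (2 * a) (x - t)) = 0"
    using assms integral_of_derivative[of "{x}" "\<lambda>t. - \<beta>per (Suc (2 * a)) (x - t)"
        "\<lambda>t. \<beta>per (2 * a) (x - t)"]
    by (simp add: continuous_on_minus continuous_on_\<beta>per_diff \<beta>per_0 \<beta>per_1)
  have "integral {0..1} (sob_jet a x 0)
      = integral {0..1} (\<lambda>t. (\<Sum>\<tau>=1..a. \<beta> \<tau> t * \<beta> \<tau> x) + (- 1) ^ (a + 1) * \<beta>per (2 * a) (x - t))"
    by (simp add: sob_jet_def[abs_def])
  also have "\<dots> = integral {0..1} (\<lambda>t. \<Sum>\<tau>=1..a. \<beta> \<tau> t * \<beta> \<tau> x)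
      + integral {0..1} (\<lambda>t. (- 1) ^ (a + 1) * \<beta>per (2 * a) (x - t))"
    using assms by (intro integral_add integrable_continuous_real continuous_intros
        continuous_on_\<beta>per_diff) auto
  also have "integral {0..1} (\<lambda>t. \<Sum>\<tau>=1..a. \<beta> \<tau> t * \<beta> \<tau> x)
      = (\<Sum>\<tau>=1..a. integral {0..1} (\<lambda>t. \<beta> \<tau> t * \<beta> \<tau> x))"
    by (intro integral_sum integrable_continuous_real continuous_intros) auto
  also have "\<dots> = 0"
    by (intro sum.neutral ballI) (use integral_\<beta> in \<open>auto simp: Suc_le_eq gr0_conv_Suc\<close>)
  finally show ?thesis using 1 by simp
qed

text \<open>Euler-Maclaurin is applied to the kernel sections themselves: their boundary differences
  and top derivatives are again the features, which produces a sum of squares.\<close>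

lemma sob_form:
  assumes xs: "xs \<in> combos {0..1}"
  shows "form (mean_zero_part (sob_kernel1 (n + 2))) xs xs
    = (\<Sum>i\<le>n. (lin xs (\<beta> (Suc i)))\<^sup>2)
      + integral {0..1} (\<lambda>t. (lin xs (\<lambda>y. remainder (n + 2) y t))\<^sup>2)"
proof -
  let ?w = "\<lambda>t. lin xs (\<lambda>y. remainder (n + 2) y t)"
  have w: "continuous_on {0..1} ?w"
    by (intro continuous_on_lin[OF xs] continuous_on_remainder) auto
  have "form (mean_zero_part (sob_kernel1 (n + 2))) xs xs
      = lin xs (\<lambda>x. (\<Sum>i\<le>n. \<beta> (Suc i) x * lin xs (\<beta> (Suc i)))
        + integral {0..1} (\<lambda>t. remainder (n + 2) x t * ?w t))"
    unfolding form_def sob_jet_0[symmetric]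
  proof (rule lin_cong[OF xs])
    fix x :: real assume x: "x \<in> {0..1}"
    show "lin xs (sob_jet (n + 2) x 0) = (\<Sum>i\<le>n. \<beta> (Suc i) x * lin xs (\<beta> (Suc i)))
        + integral {0..1} (\<lambda>t. remainder (n + 2) x t * ?w t)"
      using lin_Euler_Maclaurin[OF jet_sob_jet integral_sob_jet[OF _ x] xs, of n]
      by (simp add: sob_jet_boundary[OF _ x] sob_jet_top)
  qed
  also have "\<dots> = (\<Sum>i\<le>n. (lin xs (\<beta> (Suc i)))\<^sup>2)
      + lin xs (\<lambda>x. integral {0..1} (\<lambda>t. remainder (n + 2) x t * ?w t))"
    by (simp add: lin_add lin_sum lin_cmult_right power2_eq_square)
  also have "lin xs (\<lambda>x. integral {0..1} (\<lambda>t. remainder (n + 2) x t * ?w t))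
      = integral {0..1} (\<lambda>t. lin xs (\<lambda>x. remainder (n + 2) x t * ?w t))"
    by (intro lin_integral[OF xs, THEN conjunct1, symmetric] integrable_continuous_real
        continuous_intros continuous_on_remainder w) auto
  finally show ?thesis by (simp add: lin_cmult_right power2_eq_square)
qed

text \<open>The system is orthogonal with squared norms at most c rather than normalised, so
  constant functions of any size fit. For a one-element index set this is Cauchy-Schwarz.\<close>

lemma Bessel_inequality:
  fixes w :: "real \<Rightarrow> real" and e :: "'i \<Rightarrow> real \<Rightarrow> real"
  assumes "finite I" "c > 0" "continuous_on {0..1} w"
    and e: "\<And>k. k \<in> I \<Longrightarrow> continuous_on {0..1} (e k)"
    and orth: "\<And>k l. k \<in> I \<Longrightarrow> l \<in> I \<Longrightarrow> k \<noteq> l \<Longrightarrow> integral {0..1} (\<lambda>t. e k t * e l t) = 0"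
    and norm: "\<And>k. k \<in> I \<Longrightarrow> integral {0..1} (\<lambda>t. (e k t)\<^sup>2) \<le> c"
  shows "(\<Sum>k\<in>I. (integral {0..1} (\<lambda>t. e k t * w t))\<^sup>2) \<le> c * integral {0..1} (\<lambda>t. (w t)\<^sup>2)"
proof -
  \<comment> \<open>This coefficient minimises c a^2 - 2 a I, where I is the integral of
    \<open>e k t * w t\<close>.\<close>
  define a where "a k = integral {0..1} (\<lambda>t. e k t * w t) / c" for k
  define s where "s t = (\<Sum>k\<in>I. a k * e k t)" for t
  have s: "continuous_on {0..1} s" unfolding s_def by (intro continuous_intros e)
  have int_s: "integral {0..1} (\<lambda>t. s t * g t) = (\<Sum>k\<in>I. a k * integral {0..1} (\<lambda>t. e k t * g t))"
    if "continuous_on {0..1} g" for g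
  proof -
    have "integral {0..1} (\<lambda>t. s t * g t) = integral {0..1} (\<lambda>t. \<Sum>k\<in>I. a k * (e k t * g t))"
      by (simp add: s_def sum_distrib_right mult.assoc)
    also have "\<dots> = (\<Sum>k\<in>I. integral {0..1} (\<lambda>t. a k * (e k t * g t)))"
      by (intro integral_sum \<open>finite I\<close> integrable_continuous_real continuous_intros e that)
    finally show ?thesis by simp
  qed
  have es: "integral {0..1} (\<lambda>t. e k t * s t) = a k * integral {0..1} (\<lambda>t. (e k t)\<^sup>2)"
    if k: "k \<in> I" for k
  proof -
    have "integral {0..1} (\<lambda>t. e k t * s t) = (\<Sum>l\<in>I. a l * integral {0..1} (\<lambda>t. e l t * e k t))"
      using int_s[OF e[OF k]] by (simp add: mult.commute)
    also have "\<dots> = (\<Sum>l\<in>I. if l = k then a k * integral {0..1} (\<lambda>t. (e k t)\<^sup>2) else 0)"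
      by (rule sum.cong) (use k orth in \<open>auto simp: power2_eq_square\<close>)
    finally show ?thesis using k \<open>finite I\<close> by simp
  qed
  have "0 \<le> integral {0..1} (\<lambda>t. (w t - s t)\<^sup>2)"
    by (intro integral_nonneg integrable_continuous_real continuous_intros assms s) auto
  also have "\<dots> = integral {0..1} (\<lambda>t. (w t)\<^sup>2 - 2 * (s t * w t) + s t * s t)"
    by (simp add: power2_eq_square algebra_simps)
  also have "\<dots> = integral {0..1} (\<lambda>t. (w t)\<^sup>2) - 2 * integral {0..1} (\<lambda>t. s t * w t)
      + integral {0..1} (\<lambda>t. s t * s t)"
    by (subst integral_add integral_diff;
        (intro integrable_continuous_real continuous_intros assms s)?)+ simp
  also have "integral {0..1} (\<lambda>t. s t * w t) = (\<Sum>k\<in>I. a k * (c * a k))"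
    using \<open>c > 0\<close> by (simp add: int_s[OF assms(3)]) (simp add: a_def)
  also have "integral {0..1} (\<lambda>t. s t * s t) \<le> (\<Sum>k\<in>I. a k * (c * a k))"
    unfolding int_s[OF s]
  proof (rule sum_mono)
    fix k assume k: "k \<in> I"
    have "a k * integral {0..1} (\<lambda>t. e k t * s t) = (a k)\<^sup>2 * integral {0..1} (\<lambda>t. (e k t)\<^sup>2)"
      by (simp add: es[OF k] power2_eq_square)
    also have "\<dots> \<le> (a k)\<^sup>2 * c" by (intro mult_left_mono norm k) simp
    finally show "a k * integral {0..1} (\<lambda>t. e k t * s t) \<le> a k * (c * a k)"
      by (simp add: power2_eq_square mult_ac)
  qed
  finally have "(\<Sum>k\<in>I. a k * (c * a k)) \<le> integral {0..1} (\<lambda>t. (w t)\<^sup>2)" by simp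
  then have "c * (\<Sum>k\<in>I. a k * (c * a k)) \<le> c * integral {0..1} (\<lambda>t. (w t)\<^sup>2)"
    using \<open>c > 0\<close> by (intro mult_left_mono) auto
  then show ?thesis
    using \<open>c > 0\<close> by (simp add: a_def sum_distrib_left power2_eq_square)
qed

text \<open>The boundary part is estimated by Cauchy-Schwarz over the n + 1 orders. The integral is
  left as it stands, so that over a family of functions it can be summed by Bessel's
  inequality.\<close>

lemma jet_bound:
  assumes F: "jet (n + 2) F" and mean: "integral {0..1} (F 0) = 0" and xs: "xs \<in> combos {0..1}"
    and m: "\<And>i. i \<le> n \<Longrightarrow> \<bar>F i 1 - F i 0\<bar> \<le> m"
  shows "(lin xs (F 0))\<^sup>2 \<le> 2 * real (n + 1) * m\<^sup>2 * (\<Sum>i\<le>n. (lin xs (\<beta> (Suc i)))\<^sup>2)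
    + 2 * (integral {0..1} (\<lambda>t. F (n + 2) t * lin xs (\<lambda>y. remainder (n + 2) y t)))\<^sup>2"
proof -
  let ?A = "\<Sum>i\<le>n. (F i 1 - F i 0) * lin xs (\<beta> (Suc i))"
  let ?B = "integral {0..1} (\<lambda>t. F (n + 2) t * lin xs (\<lambda>y. remainder (n + 2) y t))"
  have "?A\<^sup>2 \<le> (\<Sum>i\<le>n. (F i 1 - F i 0)\<^sup>2) * (\<Sum>i\<le>n. (lin xs (\<beta> (Suc i)))\<^sup>2)"
    by (rule Cauchy_Schwarz_ineq_sum)
  also have "\<dots> \<le> (\<Sum>i\<le>n. m\<^sup>2) * (\<Sum>i\<le>n. (lin xs (\<beta> (Suc i)))\<^sup>2)"
    by (intro mult_right_mono sum_mono sum_nonneg)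
      (use m in \<open>auto intro!: power2_le_iff_abs_le[THEN iffD2] intro: order_trans[OF abs_ge_zero]\<close>)
  finally have A: "?A\<^sup>2 \<le> real (n + 1) * m\<^sup>2 * (\<Sum>i\<le>n. (lin xs (\<beta> (Suc i)))\<^sup>2)" by simp
  have "(lin xs (F 0))\<^sup>2 = (?A + ?B)\<^sup>2" using lin_Euler_Maclaurin[OF F mean xs] by simp
  also have "\<dots> \<le> 2 * ?A\<^sup>2 + 2 * ?B\<^sup>2"
    using sum_squares_ge_zero[of "?A - ?B" 0] by (simp add: power2_eq_square algebra_simps)
  also have "\<dots> \<le> 2 * (real (n + 1) * m\<^sup>2 * (\<Sum>i\<le>n. (lin xs (\<beta> (Suc i)))\<^sup>2)) + 2 * ?B\<^sup>2"
    using A by simp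
  finally show ?thesis by (simp only: mult.assoc)
qed

section \<open>Comparison of the univariate kernels\<close>

lemma psd_sob_kernel1: "psd_kernel {0..1} (mean_zero_part (sob_kernel1 (n + 2)))"
proof
  show "mean_zero_part (sob_kernel1 (n + 2)) x y = mean_zero_part (sob_kernel1 (n + 2)) y x" for x y
    by (simp add: sob_kernel1_def mult.commute abs_minus_commute)
  fix xs :: "(real \<times> real) list" assume xs: "xs \<in> combos {0..1}"
  show "0 \<le> form (mean_zero_part (sob_kernel1 (n + 2))) xs xs"
    unfolding sob_form[OF xs]
    by (intro add_nonneg_nonneg sum_nonneg integral_nonneg integrable_continuous_real
        continuous_intros continuous_on_lin[OF xs] continuous_on_remainder) auto
qed

lemma sob_form_parts:
  assumes xs: "xs \<in> combos {0..1}"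
  shows "(\<Sum>i\<le>n. (lin xs (\<beta> (Suc i)))\<^sup>2) \<le> form (mean_zero_part (sob_kernel1 (n + 2))) xs xs"
    and "integral {0..1} (\<lambda>t. (lin xs (\<lambda>y. remainder (n + 2) y t))\<^sup>2)
      \<le> form (mean_zero_part (sob_kernel1 (n + 2))) xs xs"
proof -
  have "0 \<le> integral {0..1} (\<lambda>t. (lin xs (\<lambda>y. remainder (n + 2) y t))\<^sup>2)"
    by (intro integral_nonneg integrable_continuous_real continuous_intros
        continuous_on_lin[OF xs] continuous_on_remainder) auto
  then show "(\<Sum>i\<le>n. (lin xs (\<beta> (Suc i)))\<^sup>2) \<le> form (mean_zero_part (sob_kernel1 (n + 2))) xs xs"
    unfolding sob_form[OF xs] by simp
  show "integral {0..1} (\<lambda>t. (lin xs (\<lambda>y. remainder (n + 2) y t))\<^sup>2)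
      \<le> form (mean_zero_part (sob_kernel1 (n + 2))) xs xs"
    unfolding sob_form[OF xs] by (simp add: sum_nonneg)
qed

lemma continuous_on_lin_remainder:
  "xs \<in> combos {0..1} \<Longrightarrow> continuous_on {0..1} (\<lambda>t. lin xs (\<lambda>y. remainder (n + 2) y t))"
  by (rule continuous_on_lin) (simp_all add: continuous_on_remainder)

lemma jet_dominated:
  assumes F: "jet (n + 2) F" and mean: "integral {0..1} (F 0) = 0"
  shows "\<exists>C. psd_kernel {0..1} (\<lambda>x y. C * mean_zero_part (sob_kernel1 (n + 2)) x y - F 0 x * F 0 y)"
proof -
  let ?K = "mean_zero_part (sob_kernel1 (n + 2))"
  define m where "m = (\<Sum>i\<le>n. \<bar>F i 1 - F i 0\<bar>)"
  have m: "\<bar>F i 1 - F i 0\<bar> \<le> m" if "i \<le> n" for i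
    unfolding m_def using that by (intro member_le_sum) auto
  \<comment> \<open>The summand 1 keeps c positive when \<open>F (n + 2)\<close> vanishes, as it
    does for \<beta> 2 and n > 0.\<close>
  define c where "c = integral {0..1} (\<lambda>t. (F (n + 2) t)\<^sup>2) + 1"
  have "0 \<le> integral {0..1} (\<lambda>t. (F (n + 2) t)\<^sup>2)"
    by (intro integral_nonneg integrable_continuous_real continuous_intros jet_continuous[OF F]) auto
  then have c: "c > 0" by (simp add: c_def)
  define C where "C = 2 * real (n + 1) * m\<^sup>2 + 2 * c"
  have bound: "(lin xs (F 0))\<^sup>2 \<le> C * form ?K xs xs" if xs: "xs \<in> combos {0..1}" for xs
  proof -
    let ?w = "\<lambda>t. lin xs (\<lambda>y. remainder (n + 2) y t)"
    have "(integral {0..1} (\<lambda>t. F (n + 2) t * ?w t))\<^sup>2 \<le> c * integral {0..1} (\<lambda>t. (?w t)\<^sup>2)"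
      using Bessel_inequality[of "{()}" c ?w "\<lambda>_. F (n + 2)"] c jet_continuous[OF F, of "n + 2"]
        continuous_on_lin_remainder[OF xs, of n] by (simp add: c_def)
    also have "\<dots> \<le> c * form ?K xs xs"
      using sob_form_parts(2)[OF xs] c by (intro mult_left_mono) auto
    finally have 1: "(integral {0..1} (\<lambda>t. F (n + 2) t * ?w t))\<^sup>2 \<le> c * form ?K xs xs" .
    have "(lin xs (F 0))\<^sup>2 \<le> 2 * real (n + 1) * m\<^sup>2 * (\<Sum>i\<le>n. (lin xs (\<beta> (Suc i)))\<^sup>2)
        + 2 * (integral {0..1} (\<lambda>t. F (n + 2) t * ?w t))\<^sup>2"
      by (rule jet_bound[OF F mean xs m])
    also have "\<dots> \<le> 2 * real (n + 1) * m\<^sup>2 * form ?K xs xs + 2 * (c * form ?K xs xs)"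
      by (intro add_mono mult_left_mono 1 sob_form_parts(1)[OF xs]) auto
    finally show ?thesis by (simp add: C_def algebra_simps)
  qed
  have "psd_kernel {0..1} (\<lambda>x y. C * ?K x y - F 0 x * F 0 y)"
  proof
    show "C * ?K x y - F 0 x * F 0 y = C * ?K y x - F 0 y * F 0 x" if "x \<in> {0..1}" "y \<in> {0..1}" for x y
      using psd_kernel.kernel_sym[OF psd_sob_kernel1 that] by (simp add: mult.commute)
    show "0 \<le> form (\<lambda>x y. C * ?K x y - F 0 x * F 0 y) xs xs" if "xs \<in> combos {0..1}" for xs
      using bound[OF that] unfolding form_diff form_cmult form_rank_one by simp
  qed
  then show ?thesis by blast
qed

lemma \<beta>_2_dominated:
  "\<exists>C. psd_kernel {0..1} (\<lambda>x y. C * mean_zero_part (sob_kernel1 (n + 2)) x y - \<beta> 2 x * \<beta> 2 y)"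
proof -
  define F where "F i = (if i \<le> 2 then \<beta> (2 - i) else (\<lambda>_. 0))" for i :: nat
  have "jet (n + 2) F"
    unfolding jet_def
  proof (intro conjI exI[of _ "{}"] allI ballI impI)
    show "continuous_on {0..1} (F i)" for i by (auto simp: F_def continuous_on_\<beta>)
    fix i :: nat and t
    consider "i = 0" | "i = 1" | "i = 2" | "i > 2" by linarith
    then show "(F i has_real_derivative F (Suc i) t) (at t)"
    proof cases
      case 1
      then show ?thesis using \<beta>_derivative[of 1 t] by (simp add: F_def numeral_2_eq_2)
    next
      case 2
      then show ?thesis using \<beta>_derivative[of 0 t] by (simp add: F_def numeral_2_eq_2)
    qed (auto simp: F_def \<beta>_0[abs_def])
  qed simp
  moreover have "integral {0..1} (F 0) = 0"
    using integral_\<beta>[of 1] by (simp add: F_def numeral_2_eq_2)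
  ultimately show ?thesis using jet_dominated[of n F] by (simp add: F_def)
qed

section \<open>Trigonometric features\<close>

text \<open>Differentiation shifts the phase by pi/2, so cosines (\<phi> = 0) and sines (\<phi> =
  -pi/2) with all their derivatives share one formula.\<close>

definition trig_jet :: "real \<Rightarrow> real \<Rightarrow> nat \<Rightarrow> real \<Rightarrow> real" where
  "trig_jet \<omega> \<phi> i t = \<omega> ^ i * cos (\<omega> * t + (\<phi> + real i * (pi / 2)))"

lemma jet_trig_jet: "jet a (trig_jet \<omega> \<phi>)"
  unfolding jet_def
proof (intro conjI exI[of _ "{}"] allI ballI impI)
  show "continuous_on {0..1} (trig_jet \<omega> \<phi> i)" for i
    unfolding trig_jet_def[abs_def] by (intro continuous_intros)
  fix i t
  have "trig_jet \<omega> \<phi> (Suc i) t = \<omega> ^ Suc i * cos (\<omega> * t + (\<phi> + real i * (pi / 2)) + pi / 2)"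
    by (simp add: trig_jet_def algebra_simps add_divide_distrib)
  also have "\<dots> = - (\<omega> ^ Suc i * sin (\<omega> * t + (\<phi> + real i * (pi / 2))))"
    by (simp add: cos_add[of _ "pi / 2"])
  finally show "(trig_jet \<omega> \<phi> i has_real_derivative trig_jet \<omega> \<phi> (Suc i) t) (at t)"
    unfolding trig_jet_def[abs_def] by (auto intro!: derivative_eq_intros)
qed simp

lemma integral_cos:
  assumes "a \<noteq> (0::real)"
  shows "integral {0..1} (\<lambda>t. cos (a * t + b)) = (sin (a + b) - sin b) / a"
proof -
  have "((\<lambda>t. sin (a * t + b) / a) has_real_derivative cos (a * t + b)) (at t)" for t
    using assms by (auto intro!: derivative_eq_intros)
  then show ?thesis
    using integral_of_derivative[of "{}" "\<lambda>t. sin (a * t + b) / a" "\<lambda>t. cos (a * t + b)"]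
    by (simp add: assms continuous_intros diff_divide_distrib)
qed

lemma integral_cos_int:
  assumes "j \<noteq> 0"
  shows "integral {0..1} (\<lambda>t. cos (pi * of_int j * t + pi * of_int z)) = (0::real)"
proof -
  have "sin (pi * of_int z) = (0::real)" for z :: int
    by (metis mult.commute sin_int_2pin sin_zero_iff_int2)
  from this[of "j + z"] this[of z] show ?thesis
    using assms integral_cos[of "pi * of_int j" "pi * of_int z"] by (simp add: algebra_simps)
qed

text \<open>The product is half the sum of cosines of frequencies pi (k - l) and pi (k + l) with
  phases 0 and 2 \<psi>. Both frequencies are nonzero and both phases are multiples of pi, so both
  integrals vanish.\<close>

lemma cos_orthogonal:
  fixes k l :: nat
  assumes "k \<noteq> l" "2 * \<psi> = pi * of_int z"
  shows "integral {0..1} (\<lambda>t. cos (pi * k * t + \<psi>) * cos (pi * l * t + \<psi>)) = (0::real)"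
proof -
  have "integral {0..1} (\<lambda>t. cos (pi * k * t + \<psi>) * cos (pi * l * t + \<psi>))
      = integral {0..1} (\<lambda>t. (cos (pi * of_int (int k - int l) * t + pi * of_int 0)
        + cos (pi * of_int (int k + int l) * t + pi * of_int z)) / 2)"
    by (simp add: cos_times_cos algebra_simps flip: assms(2))
  also have "\<dots> = (integral {0..1} (\<lambda>t. cos (pi * of_int (int k - int l) * t + pi * of_int 0))
        + integral {0..1} (\<lambda>t. cos (pi * of_int (int k + int l) * t + pi * of_int z))) / 2"
    by (simp only: integral_divide)
      (subst integral_add, auto intro!: integrable_continuous_real continuous_intros)
  also have "\<dots> = 0" using assms(1) by (subst (1 2) integral_cos_int) auto
  finally show ?thesis .
qed

lemma sum_inverse_fourth_bounded: "\<exists>S. \<forall>N. (\<Sum>k<N. 1 / real (Suc k) ^ 4) \<le> S"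
proof -
  have "summable (\<lambda>k. inverse (real (Suc k) ^ 4))"
    using inverse_power_summable[of 4, where 'a = real] by (subst summable_Suc_iff) simp
  then have "(\<Sum>k<N. inverse (real (Suc k) ^ 4)) \<le> (\<Sum>k. inverse (real (Suc k) ^ 4))" for N
    by (rule sum_le_suminf) auto
  then show ?thesis by (auto simp: divide_inverse)
qed

text \<open>The \<open>a\<close>-th derivatives of the features form an orthogonal system, so Bessel's inequality
  applies; the boundary terms of the lower derivatives are square summable because they lose
  at least two powers of the frequency.\<close>

lemma trig_family_dominated:
  fixes m :: "nat \<Rightarrow> nat"
  assumes "inj m" and m: "\<And>k. 1 \<le> m k" "\<And>k. m k \<le> 2 * Suc k"
    and mean: "\<And>k. sin (pi * m k + \<phi>) = sin \<phi>" and \<phi>: "2 * \<phi> = pi * of_int z"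
  shows "\<exists>C. \<forall>xs\<in>combos {0..1}. \<forall>N.
    (\<Sum>k<N. (lin xs (\<lambda>x. cos (pi * m k * x + \<phi>)))\<^sup>2 / real (Suc k) ^ (2 * (n + 2)))
      \<le> C * form (mean_zero_part (sob_kernel1 (n + 2))) xs xs"
proof -
  obtain S where S: "\<And>N. (\<Sum>k<N. 1 / real (Suc k) ^ 4) \<le> S"
    using sum_inverse_fourth_bounded by blast
  define \<psi> where "\<psi> = \<phi> + real (n + 2) * (pi / 2)"
  have \<psi>: "2 * \<psi> = pi * of_int (z + int (n + 2))"
    using \<phi> by (simp add: \<psi>_def algebra_simps)
  define \<omega> where "\<omega> k = pi * real (m k)" for k
  have \<omega>1: "1 \<le> \<omega> k" for k
    using mult_mono[of 1 pi 1 "real (m k)"] m(1)[of k] pi_ge_two by (simp add: \<omega>_def)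
  have \<omega>2: "\<omega> k \<le> 2 * pi * real (Suc k)" for k
  proof -
    have "real (m k) \<le> real (2 * Suc k)" using m(2) by (simp only: of_nat_le_iff)
    then show ?thesis by (simp add: \<omega>_def)
  qed
  let ?K = "mean_zero_part (sob_kernel1 (n + 2))"
  \<comment> \<open>In \<open>jet_bound\<close> the boundary differences are at most 2 (2 pi k)^n,
    which gives 2 (n + 1) 4 (2 pi)^(2n). The powers k^(2n) and k^(2n+4) leave k^(-4).\<close>
  define A where "A = 8 * real (n + 1) * (2 * pi) ^ (2 * n)"
  define B where "B = 2 * (2 * pi) ^ (2 * (n + 2))"
  have "A \<ge> 0" "B \<ge> 0" by (simp_all add: A_def B_def)
  have "(\<Sum>k<N. (lin xs (\<lambda>x. cos (pi * m k * x + \<phi>)))\<^sup>2 / real (Suc k) ^ (2 * (n + 2)))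
      \<le> (A * S + B) * form ?K xs xs" if xs: "xs \<in> combos {0..1}" for xs N
  proof -
    let ?w = "\<lambda>t. lin xs (\<lambda>y. remainder (n + 2) y t)"
    define b where "b = (\<Sum>i\<le>n. (lin xs (\<beta> (Suc i)))\<^sup>2)"
    have "b \<ge> 0" unfolding b_def by (intro sum_nonneg) simp
    define v where "v k = integral {0..1} (\<lambda>t. cos (pi * m k * t + \<psi>) * ?w t)" for k
    have term_le: "(lin xs (\<lambda>x. cos (pi * m k * x + \<phi>)))\<^sup>2 / real (Suc k) ^ (2 * (n + 2))
        \<le> A * b * (1 / real (Suc k) ^ 4) + B * (v k)\<^sup>2" for k
    proof -
      let ?F = "trig_jet (\<omega> k) \<phi>" and ?k = "real (Suc k)"
      have F0: "?F 0 = (\<lambda>x. cos (pi * m k * x + \<phi>))"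
        by (intro ext) (simp add: trig_jet_def \<omega>_def)
      have "integral {0..1} (?F 0) = 0"
        unfolding F0 using integral_cos[of "pi * m k" \<phi>] mean m(1)[of k] by simp
      moreover have "\<bar>?F i 1 - ?F i 0\<bar> \<le> 2 * (2 * pi * ?k) ^ n" if "i \<le> n" for i
      proof -
        have "\<bar>?F i t\<bar> \<le> \<omega> k ^ i" for t
          using \<omega>1[of k] by (simp add: trig_jet_def abs_mult mult_left_le)
        from this[of 0] this[of 1] have "\<bar>?F i 1 - ?F i 0\<bar> \<le> 2 * \<omega> k ^ i" by linarith
        also have "\<dots> \<le> 2 * \<omega> k ^ n" using \<omega>1[of k] that by (simp add: power_increasing)
        also have "\<dots> \<le> 2 * (2 * pi * ?k) ^ n"
          using \<omega>1[of k] \<omega>2[of k] by (intro mult_left_mono power_mono) auto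
        finally show ?thesis .
      qed
      ultimately have "(lin xs (?F 0))\<^sup>2 \<le> 2 * real (n + 1) * (2 * (2 * pi * ?k) ^ n)\<^sup>2 * b
          + 2 * (integral {0..1} (\<lambda>t. ?F (n + 2) t * ?w t))\<^sup>2"
        unfolding b_def by (intro jet_bound[OF jet_trig_jet _ xs]) auto
      also have "integral {0..1} (\<lambda>t. ?F (n + 2) t * ?w t) = \<omega> k ^ (n + 2) * v k"
        by (simp add: trig_jet_def v_def \<omega>_def \<psi>_def mult.assoc)
      also have "2 * (\<omega> k ^ (n + 2) * v k)\<^sup>2 \<le> B * ?k ^ (2 * (n + 2)) * (v k)\<^sup>2"
      proof -
        have "(\<omega> k ^ (n + 2))\<^sup>2 \<le> ((2 * pi * ?k) ^ (n + 2))\<^sup>2"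
          using \<omega>1[of k] \<omega>2[of k] by (intro power_mono) auto
        also have "\<dots> = (2 * pi) ^ (2 * (n + 2)) * ?k ^ (2 * (n + 2))"
          by (simp only: power_mult_distrib power_mult[symmetric] mult.commute)
        finally have "2 * (\<omega> k ^ (n + 2))\<^sup>2 \<le> B * ?k ^ (2 * (n + 2))"
          unfolding B_def mult.assoc by (intro mult_left_mono) simp_all
        then have "2 * (\<omega> k ^ (n + 2))\<^sup>2 * (v k)\<^sup>2 \<le> B * ?k ^ (2 * (n + 2)) * (v k)\<^sup>2"
          by (rule mult_right_mono) simp
        then show ?thesis by (simp only: power_mult_distrib mult.assoc)
      qed
      also have "2 * real (n + 1) * (2 * (2 * pi * ?k) ^ n)\<^sup>2 = A * ?k ^ (2 * n)"
        by (simp add: A_def power_mult_distrib power_mult[symmetric] mult.commute[of n] del: of_nat_Suc)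
      finally have "(lin xs (?F 0))\<^sup>2 / ?k ^ (2 * (n + 2))
          \<le> (A * ?k ^ (2 * n) * b + B * ?k ^ (2 * (n + 2)) * (v k)\<^sup>2) / ?k ^ (2 * (n + 2))"
        by (intro divide_right_mono) auto
      also have "\<dots> = A * b * (1 / ?k ^ 4) + B * (v k)\<^sup>2"
        by (simp add: add_divide_distrib power_add power4_eq_xxxx del: of_nat_Suc)
      finally show ?thesis unfolding F0 .
    qed
    have Bessel: "(\<Sum>k<N. (v k)\<^sup>2) \<le> 1 * integral {0..1} (\<lambda>t. (?w t)\<^sup>2)"
      unfolding v_def
    proof (rule Bessel_inequality)
      show "integral {0..1} (\<lambda>t. cos (pi * m k * t + \<psi>) * cos (pi * m l * t + \<psi>)) = 0"
        if "k \<noteq> l" for k l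
        by (rule cos_orthogonal[OF _ \<psi>]) (use that \<open>inj m\<close> in \<open>auto dest: injD\<close>)
      show "integral {0..1} (\<lambda>t. (cos (pi * m k * t + \<psi>))\<^sup>2) \<le> 1" for k
      proof -
        have "integral {0..1} (\<lambda>t. (cos (pi * m k * t + \<psi>))\<^sup>2) \<le> integral {0..1} (\<lambda>t::real. 1)"
          by (intro integral_le integrable_continuous_real continuous_intros)
            (auto simp: abs_square_le_1)
        then show ?thesis by simp
      qed
    qed (use continuous_on_lin_remainder[OF xs, of n] in \<open>auto intro!: continuous_intros\<close>)
    have "(\<Sum>k<N. (lin xs (\<lambda>x. cos (pi * m k * x + \<phi>)))\<^sup>2 / real (Suc k) ^ (2 * (n + 2)))
        \<le> (\<Sum>k<N. A * b * (1 / real (Suc k) ^ 4) + B * (v k)\<^sup>2)"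
      by (intro sum_mono term_le)
    also have "\<dots> = A * b * (\<Sum>k<N. 1 / real (Suc k) ^ 4) + B * (\<Sum>k<N. (v k)\<^sup>2)"
      by (simp only: sum.distrib sum_distrib_left)
    also have "\<dots> \<le> A * b * S + B * integral {0..1} (\<lambda>t. (?w t)\<^sup>2)"
      using S Bessel \<open>A \<ge> 0\<close> \<open>B \<ge> 0\<close> \<open>b \<ge> 0\<close> by (intro add_mono mult_left_mono) auto
    also have "\<dots> \<le> A * S * form ?K xs xs + B * form ?K xs xs"
    proof (intro add_mono mult_left_mono)
      have "S \<ge> 0" using S[of 0] by simp
      then show "A * b * S \<le> A * S * form ?K xs xs"
        using sob_form_parts(1)[OF xs, of n] \<open>A \<ge> 0\<close>
        by (simp add: b_def mult_ac mult_left_mono)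
    qed (use sob_form_parts(2)[OF xs] \<open>B \<ge> 0\<close> in auto)
    finally show ?thesis by (simp add: algebra_simps)
  qed
  then show ?thesis by blast
qed

section \<open>The kernel of the sum space\<close>

text \<open>The cosine of the difference is split by the addition theorem, so each summand is a
  combination of three rank one kernels. Sines are written as shifted cosines, and zero phases are
  kept, to fit one pattern.\<close>

definition korcos_term :: "nat \<Rightarrow> nat \<Rightarrow> real \<Rightarrow> real \<Rightarrow> real" where
  "korcos_term a k x y = 1 / real (Suc k) ^ (2 * a) *
    (cos (pi * real (2 * Suc k) * x + 0) * cos (pi * real (2 * Suc k) * y + 0)
     + cos (pi * real (2 * Suc k) * x + - (pi / 2)) * cos (pi * real (2 * Suc k) * y + - (pi / 2))
     + cos (pi * real (Suc k) * x + 0) * cos (pi * real (Suc k) * y + 0))"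

lemma real_double: "real (2 * Suc k) = 2 * real (Suc k)"
  by simp

lemma korcos_term_sums:
  assumes "1 \<le> a"
  shows "(\<lambda>k. korcos_term a k x y) sums mean_zero_part (korcos_kernel1 a) x y"
proof -
  have eq: "korcos_term a k x y = (let k = real (Suc k) in
      (cos (2 * pi * k * (x - y)) + cos (pi * k * x) * cos (pi * k * y)) / k ^ (2 * a))" for k
    unfolding korcos_term_def real_double
    by (simp add: Let_def cos_diff right_diff_distrib mult_ac del: of_nat_Suc)
  have "summable (\<lambda>k. korcos_term a k x y)"
  proof (rule summable_comparison_test')
    show "summable (\<lambda>k. 2 * inverse (real (Suc k) ^ 2))"
      using inverse_power_summable[of 2, where 'a = real]
      by (intro summable_mult, subst summable_Suc_iff) simp
    fix k
    let ?k = "real (Suc k)"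
    have "\<bar>cos (2 * pi * ?k * (x - y)) + cos (pi * ?k * x) * cos (pi * ?k * y)\<bar> \<le> 1 + 1 * 1"
      by (intro abs_triangle_ineq[THEN order_trans] add_mono)
        (auto simp: abs_mult intro!: mult_le_one)
    then have "norm (korcos_term a k x y) \<le> 2 / ?k ^ (2 * a)"
      unfolding eq Let_def by (simp add: divide_right_mono del: of_nat_Suc)
    also have "\<dots> \<le> 2 / ?k ^ 2"
      using assms by (intro divide_left_mono power_increasing) auto
    finally show "norm (korcos_term a k x y) \<le> 2 * inverse (?k ^ 2)" by (simp add: divide_inverse)
  qed
  then have "(\<lambda>k. korcos_term a k x y) sums (\<Sum>k. korcos_term a k x y)" by (rule summable_sums)
  then show ?thesis by (simp add: korcos_kernel1_def eq)
qed

lemma form_korcos_term: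
  "form (korcos_term a k) xs xs =
    (lin xs (\<lambda>x. cos (pi * real (2 * Suc k) * x + 0)))\<^sup>2 / real (Suc k) ^ (2 * a)
    + (lin xs (\<lambda>x. cos (pi * real (2 * Suc k) * x + - (pi / 2))))\<^sup>2 / real (Suc k) ^ (2 * a)
    + (lin xs (\<lambda>x. cos (pi * real (Suc k) * x + 0)))\<^sup>2 / real (Suc k) ^ (2 * a)"
  unfolding korcos_term_def[abs_def] form_cmult form_add form_rank_one
  by (simp only: distrib_left times_divide_eq_left mult_1)

lemma psd_korcos_kernel1:
  assumes "1 \<le> a"
  shows "psd_kernel {0..1} (mean_zero_part (korcos_kernel1 a))"
proof (rule psd_kernel_sums[OF _ korcos_term_sums[OF assms]])
  show "psd_kernel {0..1} (korcos_term a k)" for k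
    unfolding korcos_term_def[abs_def]
    by (intro psd_kernel_cmult psd_kernel_add psd_kernel_rank_one) simp
qed

text \<open>The families cos(2 pi k x), sin(2 pi k x) and cos(pi k x) are not jointly orthogonal,
  and the first is contained in the third. Each is therefore dominated separately and the constants
  are added.\<close>

lemma korcos_dominated:
  "\<exists>C\<ge>1. psd_kernel {0..1} (\<lambda>x y. C * mean_zero_part (sob_kernel1 (n + 2)) x y
      - mean_zero_part (korcos_kernel1 (n + 2)) x y)"
proof -
  let ?K = "mean_zero_part (sob_kernel1 (n + 2))" and ?L = "mean_zero_part (korcos_kernel1 (n + 2))"
  have inj: "inj (\<lambda>k. 2 * Suc k)" "inj Suc" by (auto simp: inj_def)
  have sin1: "sin (pi * real m + 0) = sin 0" for m
    using sin_npi[of m] by (simp add: mult.commute)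
  have sin2: "sin (pi * real (2 * Suc k) + - (pi / 2)) = sin (- (pi / 2))" for k
    using sin_npi[of "2 * Suc k"] cos_npi[of "2 * Suc k"]
    by (simp add: sin_diff mult.commute del: of_nat_Suc)
  obtain C1 where C1: "\<And>xs N. xs \<in> combos {0..1} \<Longrightarrow> (\<Sum>k<N. (lin xs (\<lambda>x.
      cos (pi * real (2 * Suc k) * x + 0)))\<^sup>2 / real (Suc k) ^ (2 * (n + 2))) \<le> C1 * form ?K xs xs"
    using trig_family_dominated[OF inj(1) _ _ sin1, where z = 0 and n = n] by auto
  obtain C2 where C2: "\<And>xs N. xs \<in> combos {0..1} \<Longrightarrow> (\<Sum>k<N. (lin xs (\<lambda>x.
      cos (pi * real (2 * Suc k) * x + - (pi / 2))))\<^sup>2 / real (Suc k) ^ (2 * (n + 2)))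
      \<le> C2 * form ?K xs xs"
    using trig_family_dominated[OF inj(1) _ _ sin2, where z = "-1" and n = n] by auto
  obtain C3 where C3: "\<And>xs N. xs \<in> combos {0..1} \<Longrightarrow> (\<Sum>k<N. (lin xs (\<lambda>x.
      cos (pi * real (Suc k) * x + 0)))\<^sup>2 / real (Suc k) ^ (2 * (n + 2))) \<le> C3 * form ?K xs xs"
    using trig_family_dominated[OF inj(2) _ _ sin1, where z = 0 and n = n] by auto
  \<comment> \<open>At least 1, as the passage to weighted products requires.\<close>
  define C where "C = max 1 (C1 + C2 + C3)"
  have "psd_kernel {0..1} (\<lambda>x y. C * ?K x y - ?L x y)"
  proof
    show "C * ?K x y - ?L x y = C * ?K y x - ?L y x" if "x \<in> {0..1}" "y \<in> {0..1}" for x y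
      using psd_kernel.kernel_sym[OF psd_sob_kernel1 that]
        psd_kernel.kernel_sym[OF psd_korcos_kernel1 that, of "n + 2"] by simp
    fix xs :: "(real \<times> real) list" assume xs: "xs \<in> combos {0..1}"
    have sums: "(\<lambda>k. form (korcos_term (n + 2) k) xs xs) sums form ?L xs xs"
      by (intro sums_form[OF xs xs] korcos_term_sums) simp
    have "form ?L xs xs \<le> (C1 + C2 + C3) * form ?K xs xs"
    proof (rule LIMSEQ_le_const2[OF sums[unfolded sums_def]], intro exI allI impI)
      fix N
      show "(\<Sum>k<N. form (korcos_term (n + 2) k) xs xs) \<le> (C1 + C2 + C3) * form ?K xs xs"
        unfolding form_korcos_term sum.distrib
        using C1[OF xs, of N] C2[OF xs, of N] C3[OF xs, of N] by (simp only: distrib_right)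
    qed
    also have "\<dots> \<le> C * form ?K xs xs"
      unfolding C_def using psd_kernel.form_nonneg[OF psd_sob_kernel1 xs]
      by (intro mult_right_mono) auto
    finally show "0 \<le> form (\<lambda>x y. C * ?K x y - ?L x y) xs xs"
      unfolding form_diff form_cmult by simp
  qed
  moreover have "C \<ge> 1" by (simp add: C_def)
  ultimately show ?thesis by blast
qed

section \<open>Strictness\<close>

text \<open>The left side is 4 sin(\<theta>)^4. Lowering the exponent by |sin \<theta>| \<le> 1
  before using |sin \<theta>| \<le> |\<theta>| leaves |\<theta>|^(5/2).\<close>

lemma one_minus_cos_bound: "(1 - cos (2 * \<theta>))\<^sup>2 \<le> 4 * sqrt \<bar>\<theta>\<bar> ^ 5" for \<theta> :: real
proof -
  define v where "v = sqrt \<bar>sin \<theta>\<bar>"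
  have v: "0 \<le> v" "v \<le> 1" "v\<^sup>2 = \<bar>sin \<theta>\<bar>" by (simp_all add: v_def)
  have "(1 - cos (2 * \<theta>))\<^sup>2 = 4 * (\<bar>sin \<theta>\<bar>\<^sup>2)\<^sup>2" by (simp add: cos_double_sin power2_eq_square)
  also have "\<dots> = 4 * v ^ 8" by (simp flip: v(3) power_mult)
  also have "\<dots> \<le> 4 * v ^ 5" using v by (simp add: power_decreasing)
  also have "\<dots> \<le> 4 * sqrt \<bar>\<theta>\<bar> ^ 5"
    unfolding v_def by (intro mult_left_mono power_mono real_sqrt_le_mono abs_sin_x_le_abs_x) auto
  finally show ?thesis .
qed

text \<open>This functional approximates \<open>\<delta> (f'(1) - f'(0))\<close>, and \<open>f'(0) = f'(1)\<close> for all \<open>f\<close> in the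
  smaller space.\<close>

definition end_difference :: "real \<Rightarrow> (real \<times> real) list" where
  "end_difference \<delta> = [(1, 1), (- 1, 1 - \<delta>), (- 1, \<delta>), (1, 0)]"

text \<open>The functional is symmetric about 1/2, so it annihilates sin(2 pi k x) and, for odd k,
  cos(pi k x). The other features yield 1 - cos of a multiple of \<delta>. Writing \<delta> = s^2
  makes \<delta>^(5/2) the power s^5, and k^(5/2) / k^4 is the summable power -3/2.\<close>

lemma korcos_term_end_difference:
  assumes "2 \<le> a" "0 \<le> s"
  shows "form (korcos_term a k) (end_difference (s\<^sup>2)) (end_difference (s\<^sup>2))
    \<le> 32 * (sqrt pi * s) ^ 5 * real (Suc k) powr (- 3 / 2)"
proof -
  let ?k = "real (Suc k)" and ?\<delta> = "s\<^sup>2"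
  define p where "p = sqrt (pi * ?k * s\<^sup>2) ^ 5"
  have p: "0 \<le> p" by (simp add: p_def)
  have c2: "cos (pi * (?k * 2)) = 1" "sin (pi * (?k * 2)) = 0"
    using cos_npi[of "2 * Suc k"] sin_npi[of "2 * Suc k"] unfolding real_double
    by (simp_all add: mult_ac del: of_nat_Suc)
  have s1: "sin (pi * ?k) = 0" using sin_npi[of "Suc k"] by (simp add: mult.commute del: of_nat_Suc)
  have A: "lin (end_difference ?\<delta>) (\<lambda>x. cos (pi * real (2 * Suc k) * x + 0))
      = 2 * (1 - cos (2 * (pi * ?k * ?\<delta>)))"
    unfolding real_double
    by (simp add: end_difference_def right_diff_distrib cos_diff c2 mult_ac del: of_nat_Suc)
  have B: "lin (end_difference ?\<delta>) (\<lambda>x. cos (pi * real (2 * Suc k) * x + - (pi / 2))) = 0"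
    unfolding real_double
    by (simp add: end_difference_def right_diff_distrib cos_diff sin_diff c2 mult_ac del: of_nat_Suc)
  have C: "lin (end_difference ?\<delta>) (\<lambda>x. cos (pi * real (Suc k) * x + 0))
      = (1 + cos (pi * ?k)) * (1 - cos (2 * (pi * ?k * ?\<delta> / 2)))"
    by (simp add: end_difference_def right_diff_distrib cos_diff s1 algebra_simps del: of_nat_Suc)
  have "(lin (end_difference ?\<delta>) (\<lambda>x. cos (pi * real (2 * Suc k) * x + 0)))\<^sup>2 \<le> 16 * p"
    unfolding A power_mult_distrib[of 2] using one_minus_cos_bound[of "pi * ?k * ?\<delta>"]
    by (simp add: p_def abs_mult del: of_nat_Suc)
  moreover have "(lin (end_difference ?\<delta>) (\<lambda>x. cos (pi * real (Suc k) * x + 0)))\<^sup>2 \<le> 16 * p"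
  proof -
    have "(1 - cos (2 * (pi * ?k * ?\<delta> / 2)))\<^sup>2 \<le> 4 * sqrt \<bar>pi * ?k * ?\<delta> / 2\<bar> ^ 5"
      by (rule one_minus_cos_bound)
    also have "\<dots> \<le> 4 * p"
      unfolding p_def by (intro mult_left_mono power_mono real_sqrt_le_mono) auto
    finally have 1: "(1 - cos (2 * (pi * ?k * ?\<delta> / 2)))\<^sup>2 \<le> 4 * p" .
    have "(1 + cos (pi * ?k))\<^sup>2 \<le> 2\<^sup>2"
      using cos_ge_minus_one[of "pi * ?k"] cos_le_one[of "pi * ?k"] by (intro power_mono) linarith+
    then have "(1 + cos (pi * ?k))\<^sup>2 * (1 - cos (2 * (pi * ?k * ?\<delta> / 2)))\<^sup>2 \<le> 2\<^sup>2 * (4 * p)"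
      using 1 by (intro mult_mono) auto
    then show ?thesis unfolding C by (simp only: power_mult_distrib) simp
  qed
  ultimately have "form (korcos_term a k) (end_difference ?\<delta>) (end_difference ?\<delta>)
      \<le> 16 * p / ?k ^ (2 * a) + 0 + 16 * p / ?k ^ (2 * a)"
    unfolding form_korcos_term B by (intro add_mono divide_right_mono) auto
  also have "\<dots> = 32 * p / ?k ^ (2 * a)" by simp
  also have "\<dots> \<le> 32 * p / ?k ^ 4"
    using assms p by (intro divide_left_mono power_increasing) auto
  also have "p = (sqrt pi * s) ^ 5 * sqrt ?k ^ 5"
    unfolding p_def using assms by (simp add: real_sqrt_mult power_mult_distrib mult_ac)
  also have "sqrt ?k ^ 5 = ?k powr (5 / 2)"
    by (simp add: powr_half_sqrt[symmetric] powr_power del: of_nat_Suc)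
  also have "32 * ((sqrt pi * s) ^ 5 * ?k powr (5 / 2)) / ?k ^ 4
      = 32 * (sqrt pi * s) ^ 5 * (?k powr (5 / 2) / ?k powr 4)"
    by (simp del: of_nat_Suc)
  also have "?k powr (5 / 2) / ?k powr 4 = ?k powr (- 3 / 2)"
    unfolding powr_diff[symmetric] by simp
  finally show ?thesis .
qed

lemma end_difference_\<beta>_2: "lin (end_difference \<delta>) (\<beta> 2) = \<delta> * (1 - \<delta>)"
  by (simp add: end_difference_def \<beta>_def bernoulli_poly_def numeral_2_eq_2 field_simps)

lemma end_difference_small:
  assumes "2 \<le> a" "e > 0"
  shows "\<exists>xs\<in>combos {0..1}. lin xs (\<lambda>_. 1) = 0 \<and>
    form (mean_zero_part (korcos_kernel1 a)) xs xs < e * (lin xs (\<beta> 2))\<^sup>2"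
proof -
  define S where "S = (\<Sum>k. real (Suc k) powr (- 3 / 2))"
  have summable: "summable (\<lambda>k. real (Suc k) powr (- 3 / 2))"
    using summable_real_powr_iff[of "- 3 / 2"] by (subst summable_Suc_iff) simp
  have "S \<ge> 0" unfolding S_def by (intro suminf_nonneg summable) simp
  define M where "M = 32 * sqrt pi ^ 5 * S"
  have "M \<ge> 0" using \<open>S \<ge> 0\<close> by (simp add: M_def)
  \<comment> \<open>The form is at most M s^5, while the square of \<delta> (1 - \<delta>) with
    \<delta> = s^2 is at least s^4 / 4. The bound 1/2 ensures 1 - \<delta> \<ge> 1/2, and the other
    one M s < e / 4.\<close>
  define s where "s = min (1 / 2) (e / (8 * (M + 1)))"
  have "0 < e / (8 * (M + 1))" using \<open>e > 0\<close> \<open>M \<ge> 0\<close> by simp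
  then have s: "0 < s" "s \<le> 1 / 2" "s \<le> e / (8 * (M + 1))"
    unfolding s_def by (simp_all only: min_less_iff_conj min.cobounded1 min.cobounded2) simp
  have s2: "s\<^sup>2 \<le> 1 / 2" using power_mono[of s "1 / 2" 2] s by (simp add: power2_eq_square)
  let ?x = "end_difference (s\<^sup>2)"
  have x: "?x \<in> combos {0..1}" using s2 by (simp add: end_difference_def)
  have "form (mean_zero_part (korcos_kernel1 a)) ?x ?x \<le> 32 * (sqrt pi * s) ^ 5 * S"
  proof (rule sums_le)
    show "(\<lambda>k. form (korcos_term a k) ?x ?x) sums form (mean_zero_part (korcos_kernel1 a)) ?x ?x"
      using assms by (intro sums_form[OF x x] korcos_term_sums) auto
    show "(\<lambda>k. 32 * (sqrt pi * s) ^ 5 * real (Suc k) powr (- 3 / 2)) sums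
        (32 * (sqrt pi * s) ^ 5 * S)"
      unfolding S_def by (intro sums_mult summable_sums summable)
    show "form (korcos_term a k) ?x ?x \<le> 32 * (sqrt pi * s) ^ 5 * real (Suc k) powr (- 3 / 2)"
      for k
      using assms s by (intro korcos_term_end_difference) auto
  qed
  also have "\<dots> = M * s * s ^ 4" by (simp add: M_def power_mult_distrib eval_nat_numeral)
  also have "\<dots> < e / 4 * s ^ 4"
  proof (intro mult_strict_right_mono)
    have "M * s \<le> M * (e / (8 * (M + 1)))" using s \<open>M \<ge> 0\<close> by (intro mult_left_mono) auto
    also have "\<dots> < e / 4" using \<open>M \<ge> 0\<close> \<open>e > 0\<close> by (simp add: field_simps add_pos_nonneg)
    finally show "M * s < e / 4" .
  qed (use s in simp)
  also have "\<dots> \<le> e * (lin ?x (\<beta> 2))\<^sup>2"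
  proof -
    have "s\<^sup>2 * (1 / 2) \<le> s\<^sup>2 * (1 - s\<^sup>2)" using s2 by (intro mult_left_mono) auto
    then have "(s\<^sup>2 * (1 / 2))\<^sup>2 \<le> (lin ?x (\<beta> 2))\<^sup>2"
      unfolding end_difference_\<beta>_2 by (intro power_mono) auto
    then have "e * (s\<^sup>2 * (1 / 2))\<^sup>2 \<le> e * (lin ?x (\<beta> 2))\<^sup>2" using \<open>e > 0\<close> by simp
    then show ?thesis by (simp add: power_mult_distrib power_divide flip: power_mult)
  qed
  finally show ?thesis using x by (intro bexI[of _ ?x]) (simp_all add: end_difference_def)
qed

theorem mainTheorem4:
  fixes \<alpha> :: nat and \<gamma> :: "'s::finite set \<Rightarrow> real"
  assumes "\<alpha> \<ge> 2"
    and "\<And>u. \<gamma> u \<ge> 0"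
    and "\<exists>u. u \<noteq> {} \<and> \<gamma> u > 0"
  shows "RKHS unit_cube (korcos_kernel \<alpha> \<gamma>) \<subset> RKHS unit_cube (sob_kernel \<alpha> \<gamma>)"
proof -
  obtain n where \<alpha>: "\<alpha> = n + 2" using assms(1) by (metis add.commute less_eqE)
  obtain u where u: "u \<noteq> {}" "\<gamma> u > 0" using assms(3) by blast
  have sob: "psd_kernel {0..1} (mean_zero_part (sob_kernel1 \<alpha>))"
    unfolding \<alpha> by (rule psd_sob_kernel1)
  have kor: "psd_kernel {0..1} (mean_zero_part (korcos_kernel1 \<alpha>))"
    using assms(1) by (intro psd_korcos_kernel1) simp
  have sob_eq: "RKHS unit_cube (sob_kernel \<alpha> \<gamma>)
      = rkhs_set unit_cube (weighted_kernel (sob_kernel1 \<alpha>) \<gamma>)"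
    unfolding sob_kernel_def by (intro RKHS_eq_rkhs_set psd_weighted_kernel sob assms(2))
  have kor_eq: "RKHS unit_cube (korcos_kernel \<alpha> \<gamma>)
      = rkhs_set unit_cube (weighted_kernel (korcos_kernel1 \<alpha>) \<gamma>)"
    unfolding korcos_kernel_def by (intro RKHS_eq_rkhs_set psd_weighted_kernel kor assms(2))
  obtain C where C: "C \<ge> 1" "psd_kernel {0..1} (\<lambda>x y. C * mean_zero_part (sob_kernel1 \<alpha>) x y
      - mean_zero_part (korcos_kernel1 \<alpha>) x y)"
    using korcos_dominated unfolding \<alpha> by blast
  have "rkhs_set unit_cube (weighted_kernel (korcos_kernel1 \<alpha>) \<gamma>)
      \<subseteq> rkhs_set unit_cube (weighted_kernel (sob_kernel1 \<alpha>) \<gamma>)"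
    by (rule rkhs_set_mono[OF psd_weighted_kernel[OF kor assms(2)]
          psd_weighted_kernel_diff[OF kor sob C(2,1) assms(2)]])
  moreover
  let ?h = "\<lambda>x\<in>unit_cube. \<Prod>j\<in>u. \<beta> 2 (x $ j)"
  have "?h \<in> rkhs_set unit_cube (weighted_kernel (sob_kernel1 \<alpha>) \<gamma>)"
    using \<beta>_2_dominated[of n] product_mem_weighted[where \<gamma> = \<gamma>, OF sob assms(2) u] unfolding \<alpha> by blast
  moreover have "?h \<notin> rkhs_set unit_cube (weighted_kernel (korcos_kernel1 \<alpha>) \<gamma>)"
  proof (rule product_not_mem_weighted[OF kor assms(2) u(1)])
    \<comment> \<open>The value is 1/12; the coordinates frozen at 0 must not annihilate the
      product.\<close>
    show "\<beta> 2 0 \<noteq> 0" by (simp add: \<beta>_def bernoulli_poly_def numeral_2_eq_2)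
  qed (rule end_difference_small[OF assms(1)])
  ultimately show ?thesis unfolding sob_eq kor_eq by blast
qed

end
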